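(* Let $d\in\mathbb{N}$ and let $\Delta$ be a Borel random variable on $\mathbb{R}^d$. Let $(\Delta_i)_{i\in\mathbb{N}}$ be independent copies of $\Delta$. Set $X_1=\Delta_1$ and, for every $n\geq 2$, let $U_n$ be uniform on $\{1,\dots,n-1\}$ (independent of everything else) and $X_n=X_{U_n}+\Delta_n$. Let $\mu_n:=\sum_{i=1}^n\delta_{X_i}$. Assume there exist $\alpha>0$ and a random variable $\Lambda$ on $\mathbb{R}^d$, with law $\mathcal L(\Lambda)$, such that $n^{-\alpha}\sum_{i=1}^n\Delta_i$ converges in distribution to $\Lambda$ as $n\to\infty$. Then almost surely, as $n\to\infty$, $\Theta_{\log(n)^{\alpha}}(\mu_n/n)$ converges weakly to $\mathcal L(\Lambda)$.
   Context: For $a>0$ and a finite Borel measure $\mu$ on $\mathbb{R}^d$, $\Theta_a(\mu)$ denotes the unique Borel measure such that $\Theta_a(\mu)(B/a)=\mu(B)$ for every Borel set $B\subset\mathbb{R}^d$ (i.e. the image of $\mu$ under $x\mapsto x/a$). *)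

theory Defs
  imports "HOL-Probability.Probability"
begin

definition weak_conv_fm :: "(nat \<Rightarrow> 'a::metric_space measure) \<Rightarrow> 'a measure \<Rightarrow> bool" where
  "weak_conv_fm \<mu>s \<mu> \<longleftrightarrow>
     (\<forall>f::'a \<Rightarrow> real. continuous_on UNIV f \<and> bounded (range f) \<longrightarrow>
        (\<lambda>n. integral\<^sup>L (\<mu>s n) f) \<longlonglongrightarrow> integral\<^sup>L \<mu> f)"

definition Theta :: "real \<Rightarrow> 'a::real_normed_vector measure \<Rightarrow> 'a measure" where
  "Theta a \<mu> = distr \<mu> borel (\<lambda>x. x /\<^sub>R a)"

definition point_sum :: "nat \<Rightarrow> (nat \<Rightarrow> 'a::topological_space) \<Rightarrow> 'a measure" where
  "point_sum n x = measure_of UNIV (sets borel) (\<lambda>A. \<Sum>i\<in>{1..n}. indicator A (x i))"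

end

theory Submission
  imports Defs "HOL-Real_Asymp.Real_Asymp"
begin

text \<open>
  Let \<open>P g x = E g (x + \<Delta>)\<close>. Given the first \<open>k\<close> positions, the mean of \<open>g (X\<^bsub>k+1\<^esub>)\<close> is the average of
  \<open>P g\<close> over \<open>X\<^sub>1, \<dots>, X\<^sub>k\<close>. Hence, with \<open>H m l\<close> the product of the operators \<open>(k + P) / (k + 1)\<close> for
  \<open>m \<le> k < m + l\<close>, the average of \<open>g\<close> over the first \<open>n\<close> positions differs from the average of
  \<open>H m (n - m) g\<close> over the first \<open>m\<close> positions by a martingale difference of variance \<open>O(1/m)\<close>.

  Take \<open>g x = f (x / ln(n)\<^sup>\<alpha>)\<close> with \<open>f\<close> Lipschitz of compact support, and \<open>m\<close> of order \<open>ln(n)\<^sup>4\<close>. The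
  function \<open>H m (n - m) g\<close> is \<open>E f ((x + W\<^sub>N) / ln(n)\<^sup>\<alpha>)\<close>, where \<open>W\<close> is the walk with steps \<open>\<Delta>\<close> and \<open>N\<close> is an
  independent sum of Bernoulli variables with \<open>N / ln n \<rightarrow> 1\<close>, so at \<open>x = 0\<close> it tends to \<open>E f \<Lambda>\<close>. The
  first \<open>m\<close> positions are mostly \<open>o(ln(n)\<^sup>\<alpha>)\<close>: tightness of \<open>W\<^sub>k / k\<^sup>\<alpha>\<close> forces a power tail on \<open>\<Delta>\<close>, by
  Ottaviani's inequality. All errors are summable along \<open>n = \<lceil>exp (sqrt i)\<rceil>\<close> if \<open>m = 4\<^sup>j\<close> is kept
  constant for \<open>2\<^sup>j \<le> i < 2\<^bsup>j+1\<^esup>\<close>, and consecutive such \<open>n\<close> have ratio tending to \<open>1\<close>.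
\<close>

section \<open>Countably many test functions for weak convergence\<close>

text \<open>The choice of \<open>n\<close> and \<open>m\<close> settles a conflict. The variances
  \<open>O(1/m)\<close> must be summable along the chosen sizes, so \<open>m\<close> has to grow
  like a power of the index \<open>i\<close> with exponent above one. But \<open>ln m\<close> must
  be negligible against \<open>ln n\<close>, or else the depth below the starting tree is not
  asymptotic to \<open>ln n\<close>. Sizes polynomial in \<open>i\<close> violate the second demand,
  and geometric ones have ratios that stay away from 1. The sizes \<open>exp (sqrt i)\<close> lie in
  between: \<open>ln n\<close> is about \<open>sqrt i\<close>, while \<open>ln m\<close> is at most
  \<open>2 * ln i\<close>.

  The dyadic blocks have another cause. The exponent in the tail of \<Delta> may be small, so the
  mean cost of moving the first \<open>m\<close> positions to the origin is, up to a logarithm, a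
  possibly small negative power of \<open>i\<close>. It need not be summable over \<open>i\<close>,
  but it is geometric in \<open>j\<close>, and one average over the first \<open>4 ^ j\<close>
  positions serves a whole block.

  No moment of \<Delta> is available, so distances enter only through the truncated norm
  \<open>min 1 (norm x / y)\<close>, which is still subadditive.\<close>

lemma point_sum_eq_distr:
  "point_sum n x = distr (count_space {1..n}) borel x"
proof -
  let ?D = "distr (count_space {1..n}) (borel :: 'a measure) x"
  have em: "emeasure ?D A = (\<Sum>i\<in>{1..n}. indicator A (x i))" if "A \<in> sets borel" for A
  proof -
    have "emeasure ?D A = emeasure (count_space {1..n}) (x -` A \<inter> {1..n})"
      using that by (simp add: emeasure_distr)
    also have "\<dots> = (\<Sum>i\<in>{1..n}. indicator (x -` A \<inter> {1..n}) i)"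
      by (subst emeasure_count_space_finite)
        (simp_all add: indicator_def Int_commute sum.If_cases vimage_def)
    also have "\<dots> = (\<Sum>i\<in>{1..n}. indicator A (x i))"
      by (intro sum.cong) (auto simp: indicator_def)
    finally show ?thesis .
  qed
  \<comment> \<open>\<open>measure_of\<close> returns the given set function only where that
    function is countably additive; agreement with a pushforward of counting measure supplies
    this.\<close>
  have "point_sum n x = measure_of UNIV (sets borel) (emeasure ?D)"
    unfolding point_sum_def
  proof (rule measure_of_eq)
    fix A assume "A \<in> sigma_sets UNIV (sets (borel :: 'a measure))"
    then have "A \<in> sets borel"
      by (metis sets.sigma_sets_eq space_borel)
    then show "(\<Sum>i\<in>{1..n}. indicator A (x i)) = emeasure ?D A"
      by (simp only: em)
  qed auto
  also have "\<dots> = ?D"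
    using measure_of_of_measure[of ?D] by simp
  finally show ?thesis .
qed

lemma prob_space_Theta_point_sum:
  assumes "n \<ge> 1"
  shows "prob_space (Theta a (scale_measure (ennreal (1 / real n)) (point_sum n x)))"
    (is "prob_space (Theta a ?S)")
proof -
  have "emeasure ?S UNIV = ennreal (1 / real n) * of_nat n"
    by (simp add: point_sum_eq_distr emeasure_distr emeasure_count_space_finite)
  also have "\<dots> = 1"
    using assms by (simp add: ennreal_of_nat_eq_real_of_nat flip: ennreal_mult)
  finally have "prob_space ?S"
    by (intro prob_spaceI) (simp add: space_scale_measure point_sum_eq_distr)
  moreover have "(\<lambda>x. x /\<^sub>R a) \<in> borel_measurable ?S"
    by (simp add: point_sum_eq_distr)
  ultimately show ?thesis
    unfolding Theta_def by (rule prob_space.prob_space_distr)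
qed

lemma integral_Theta_point_sum:
  fixes f :: "'a::{real_normed_vector, second_countable_topology} \<Rightarrow> real"
  assumes f: "f \<in> borel_measurable borel"
  shows "integral\<^sup>L (Theta a (scale_measure (ennreal (1 / real n)) (point_sum n x))) f
           = (\<Sum>i=1..n. f (x i /\<^sub>R a)) / real n"
proof -
  have [measurable]: "(\<lambda>x::'a. x /\<^sub>R a) \<in> borel_measurable borel" by simp
  note f[measurable]
  let ?P = "distr (count_space {1..n}) borel x"
  have sc: "scale_measure (ennreal (1 / real n)) ?P = density ?P (\<lambda>_. ennreal (1 / real n))"
    by (intro measure_eqI) (auto simp: emeasure_density_const)
  have "integral\<^sup>L (Theta a (scale_measure (ennreal (1 / real n)) (point_sum n x))) f
      = integral\<^sup>L (scale_measure (ennreal (1 / real n)) ?P) (\<lambda>x. f (x /\<^sub>R a))"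
    unfolding Theta_def point_sum_eq_distr by (subst integral_distr) auto
  also have "\<dots> = (\<integral>x. (1 / real n) *\<^sub>R f (x /\<^sub>R a) \<partial>?P)"
    unfolding sc by (subst integral_density) auto
  also have "\<dots> = (\<Sum>i=1..n. (1 / real n) * f (x i /\<^sub>R a))"
    by (subst integral_distr) (simp_all add: lebesgue_integral_count_space_finite sum_divide_distrib)
  also have "\<dots> = (\<Sum>i=1..n. f (x i /\<^sub>R a)) / real n"
    by (simp add: sum_divide_distrib)
  finally show ?thesis .
qed

text \<open>A cone with centre \<open>c\<close>, slope \<open>Suc r\<close> and height
  \<open>q\<close>. The slope is never 0, so the cone vanishes off a ball; with centres in a
  countable set the family is countable.\<close>

definition tent :: "'a::metric_space \<times> nat \<times> rat \<Rightarrow> 'a \<Rightarrow> real" where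
  "tent p x = (case p of (c, r, q) \<Rightarrow> max 0 (of_rat q - real (Suc r) * dist x c))"

definition max_tents :: "('a::metric_space \<times> nat \<times> rat) list \<Rightarrow> 'a \<Rightarrow> real" where
  "max_tents ps x = foldr (\<lambda>p. max (tent p x)) ps 0"

lemma max_tents_simps [simp]:
  "max_tents [] x = 0" "max_tents (p # ps) x = max (tent p x) (max_tents ps x)"
  by (simp_all add: max_tents_def)

lemma continuous_on_max_tents: "continuous_on UNIV (max_tents ps)"
proof (induction ps)
  case (Cons p ps)
  have "continuous_on UNIV (\<lambda>x. max (tent p x) (max_tents ps x))"
    using Cons unfolding tent_def by (cases p) (auto intro!: continuous_intros)
  then show ?case
    by (simp add: max_tents_def[abs_def])
qed (simp add: max_tents_def[abs_def])

lemma max_tents_nonneg: "0 \<le> max_tents ps x"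
  by (induction ps) (auto simp: tent_def split: prod.split)

lemma tent_cs:
  "\<exists>K\<ge>0. \<exists>R\<ge>0. (\<forall>x y. \<bar>tent p x - tent p y\<bar> \<le> K * dist x y) \<and> (\<forall>x. dist x a \<ge> R \<longrightarrow> tent p x = 0)
     \<and> (\<forall>x. \<bar>tent p x\<bar> \<le> K)"
proof -
  obtain c r q where p: "p = (c, r, q)" by (cases p)
  let ?K = "max (real (Suc r)) \<bar>of_rat q\<bar>"
  have "\<bar>tent p x - tent p y\<bar> \<le> ?K * dist x y" for x y
  proof -
    have "\<bar>tent p x - tent p y\<bar> \<le> real (Suc r) * \<bar>dist x c - dist y c\<bar>"
    proof -
      have "\<bar>max 0 (u - b * s) - max 0 (u - b * t)\<bar> \<le> \<bar>b * s - b * t\<bar>" for u b s t :: real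
        by (auto simp: max_def)
      from this[of "of_rat q" "real (Suc r)" "dist x c" "dist y c"] show ?thesis
        unfolding p tent_def prod.case
        by (metis abs_mult abs_of_nat right_diff_distrib')
    qed
    also have "\<dots> \<le> ?K * dist x y"
    proof (intro mult_mono)
      show "\<bar>dist x c - dist y c\<bar> \<le> dist x y"
        using dist_triangle[of x c y] dist_triangle[of y c x] by (simp add: dist_commute abs_le_iff)
    qed auto
    finally show ?thesis .
  qed
  moreover have "tent p x = 0" if "dist x a \<ge> dist a c + \<bar>of_rat q\<bar>" for x
  proof -
    have "of_rat q \<le> dist x c"
      using that dist_triangle[of x a c] dist_commute[of a c] by linarith
    also have "\<dots> \<le> real (Suc r) * dist x c"
      by (simp add: mult_le_cancel_right1)
    finally show ?thesis by (simp add: p tent_def)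
  qed
  moreover have "\<bar>tent p x\<bar> \<le> ?K" for x
  proof -
    have "real (Suc r) * dist x c \<ge> 0" by simp
    then show ?thesis unfolding p tent_def prod.case by linarith
  qed
  ultimately show ?thesis
    by (intro exI[of _ ?K] exI[of _ "dist a c + \<bar>of_rat q\<bar>"] conjI allI impI) auto
qed

lemma max_tents_cs:
  "\<exists>K\<ge>0. \<exists>R\<ge>0. (\<forall>x y. \<bar>max_tents ps x - max_tents ps y\<bar> \<le> K * dist x y)
     \<and> (\<forall>x. dist x a \<ge> R \<longrightarrow> max_tents ps x = 0) \<and> (\<forall>x. \<bar>max_tents ps x\<bar> \<le> K)"
proof (induction ps)
  case Nil
  show ?case by (auto intro!: exI[of _ 0])
next
  case (Cons p ps)
  from tent_cs[of p a] obtain K1 R1 where 1: "K1 \<ge> 0" "R1 \<ge> 0"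
    "\<And>x y. \<bar>tent p x - tent p y\<bar> \<le> K1 * dist x y" "\<And>x. dist x a \<ge> R1 \<Longrightarrow> tent p x = 0"
    "\<And>x. \<bar>tent p x\<bar> \<le> K1" by blast
  from Cons obtain K2 R2 where 2: "K2 \<ge> 0" "R2 \<ge> 0"
    "\<And>x y. \<bar>max_tents ps x - max_tents ps y\<bar> \<le> K2 * dist x y"
    "\<And>x. dist x a \<ge> R2 \<Longrightarrow> max_tents ps x = 0"
    "\<And>x. \<bar>max_tents ps x\<bar> \<le> K2" by blast
  let ?K = "max K1 K2" and ?R = "max R1 R2"
  have "\<bar>max_tents (p # ps) x - max_tents (p # ps) y\<bar> \<le> ?K * dist x y" for x y
  proof -
    have "K1 * dist x y \<le> ?K * dist x y" "K2 * dist x y \<le> ?K * dist x y"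
      by (auto intro: mult_right_mono)
    then show ?thesis using 1(3)[of x y] 2(3)[of x y] unfolding max_tents_simps by linarith
  qed
  moreover have "\<bar>max_tents (p # ps) x\<bar> \<le> ?K" for x
    using 1(5)[of x] 2(5)[of x] unfolding max_tents_simps by linarith
  ultimately show ?case
    using 1 2 by (intro exI[of _ ?K] exI[of _ ?R] conjI) (auto simp: le_max_iff_disj)
qed

text \<open>By continuity \<open>f\<close> stays above \<open>f x - e / 4\<close> near
  \<open>x\<close>. A cone slightly lower than this and steep enough to vanish outside that
  neighbourhood fits under \<open>f\<close>.\<close>

lemma tent_approx:
  fixes f :: "'a::euclidean_space \<Rightarrow> real"
  assumes f: "continuous_on UNIV f" "\<And>x. 0 \<le> f x" and e: "0 < e"
    and D: "closure D = UNIV"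
  shows "\<exists>c\<in>D. \<exists>r q. (\<forall>y. tent (c, r, q) y \<le> f y) \<and> f x - e < tent (c, r, q) x"
proof -
  from f(1) e obtain d where d: "d > 0" "\<And>y. dist y x < d \<Longrightarrow> \<bar>f y - f x\<bar> < e / 4"
    unfolding continuous_on_iff by (metis UNIV_I dist_real_def divide_pos_pos zero_less_numeral)
  obtain q where q: "f x - e / 2 < of_rat q" "of_rat q < f x - e / 4"
    using of_rat_dense[of "f x - e / 2" "f x - e / 4"] e by auto
  obtain r :: nat where r: "2 * \<bar>of_rat q\<bar> / d < real r"
    using reals_Archimedean2 by blast
  \<comment> \<open>The first entry keeps \<open>c\<close> at distance at least \<open>d / 2\<close>
    from all points where \<open>f\<close> is not controlled; there the slope has already brought
    the cone to 0. The second limits the loss of height between \<open>c\<close> and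
    \<open>x\<close> to \<open>e / 2\<close>.\<close>
  define \<delta> where "\<delta> = min (d / 2) (e / (2 * real (Suc r)))"
  have "\<delta> > 0" using d e by (auto simp: \<delta>_def)
  then obtain c where c: "c \<in> D" "dist c x < \<delta>"
    using D closure_approachable by (metis UNIV_I)
  have "tent (c, r, q) y \<le> f y" for y
  proof (cases "dist y x < d")
    case True
    then have "of_rat q \<le> f y" using d(2)[of y] q(2) by linarith
    moreover have "0 \<le> real (Suc r) * dist y c" by simp
    ultimately show ?thesis using f(2)[of y] unfolding tent_def prod.case by linarith
  next
    case False
    then have "d / 2 \<le> dist y c"
      using c(2) dist_triangle[of y x c] by (auto simp: \<delta>_def)
    then have "real (Suc r) * (d / 2) \<le> real (Suc r) * dist y c"
      by (intro mult_left_mono) auto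
    moreover have "\<bar>of_rat q\<bar> \<le> real (Suc r) * (d / 2)"
      using r d(1) by (simp add: field_simps)
    ultimately show ?thesis using f(2)[of y] unfolding tent_def prod.case by linarith
  qed
  moreover have "f x - e < tent (c, r, q) x"
  proof -
    have "real (Suc r) * dist x c \<le> real (Suc r) * (e / (2 * real (Suc r)))"
      using c(2) by (intro mult_left_mono) (auto simp: \<delta>_def dist_commute)
    also have "\<dots> = e / 2" by (simp del: of_nat_Suc)
    finally have "real (Suc r) * dist x c \<le> e / 2" .
    then show ?thesis using q(1) unfolding tent_def prod.case by linarith
  qed
  ultimately show ?thesis using c(1) by blast
qed

lemma max_tents_exhaust:
  fixes f :: "'a::euclidean_space \<Rightarrow> real"
  assumes f: "continuous_on UNIV f" "\<And>x. 0 \<le> f x"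
    and D: "countable D" "closure D = UNIV"
  shows "\<exists>ps. (\<forall>n. ps n \<in> lists (D \<times> UNIV)) \<and> (\<forall>n x. max_tents (ps n) x \<le> f x)
           \<and> (\<forall>x. (\<lambda>n. max_tents (ps n) x) \<longlonglongrightarrow> f x)"
proof -
  let ?S = "D \<times> (UNIV :: (nat \<times> rat) set)"
  have "D \<noteq> {}" using D(2) by auto
  then have ne: "?S \<noteq> {}" by auto
  have cS: "countable ?S" using D(1) by auto
  define e where "e = from_nat_into ?S"
  have range_e: "range e = ?S"
    unfolding e_def by (rule range_from_nat_into[OF ne cS])
  \<comment> \<open>Run through an enumeration of all cones and collect those lying below
    \<open>f\<close>. The maxima of the growing lists increase, and \<open>tent_approx\<close> shows
    that their supremum is \<open>f\<close>.\<close>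
  define ps where
    "ps = rec_nat [] (\<lambda>n l. if \<forall>y. tent (e n) y \<le> f y then e n # l else l)"
  have ps_simps [simp]: "ps 0 = []"
    "ps (Suc n) = (if \<forall>y. tent (e n) y \<le> f y then e n # ps n else ps n)" for n
    by (simp_all add: ps_def)
  have le: "max_tents (ps n) x \<le> f x" for n x
    by (induction n) (auto simp: f)
  have mono: "incseq (\<lambda>n. max_tents (ps n) x)" for x
    by (rule incseq_SucI) auto
  have "(\<lambda>n. max_tents (ps n) x) \<longlonglongrightarrow> f x" for x
  proof (rule increasing_LIMSEQ)
    fix \<epsilon> :: real assume "\<epsilon> > 0"
    from tent_approx[OF f this D(2), of x] obtain c r q where c: "c \<in> D"
      "\<And>y. tent (c, r, q) y \<le> f y" "f x - \<epsilon> < tent (c, r, q) x" by blast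
    then obtain i where i: "e i = (c, r, q)" using range_e by (metis (mono_tags) SigmaI UNIV_I rangeE)
    have "max_tents (ps (Suc i)) x \<ge> tent (c, r, q) x"
      using c(2) by (simp add: i)
    with c(3) show "\<exists>n. f x \<le> max_tents (ps n) x + \<epsilon>"
      by (intro exI[of _ "Suc i"]) linarith
  qed (use le mono[of x] in \<open>auto simp: incseq_Suc_iff\<close>)
  moreover have "e n \<in> ?S" for n using range_e by blast
  then have "ps n \<in> lists ?S" for n
    by (induction n) auto
  ultimately show ?thesis using le by blast
qed

lemma integrable_bounded_continuous:
  fixes f :: "'a::euclidean_space \<Rightarrow> real"
  assumes "prob_space N" "sets N = sets borel" "continuous_on UNIV f" "\<And>x. \<bar>f x\<bar> \<le> B"
  shows "integrable N f"
proof -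
  interpret prob_space N by fact
  have [measurable]: "f \<in> borel_measurable N"
    using borel_measurable_continuous_onI[OF assms(3)] measurable_cong_sets[OF assms(2) refl] by blast
  show ?thesis
    by (rule integrable_const_bound[of _ B]) (auto simp: assms)
qed

text \<open>A nonnegative continuous function is an increasing limit of maxima of finitely many tents,
  so countably many test functions control all lower limits; applied to \<open>B + f\<close> and \<open>B - f\<close>,
  this gives convergence.\<close>

lemma weak_conv_fm_max_tents:
  fixes \<nu> :: "'a::euclidean_space measure"
  assumes D: "countable D" "closure D = UNIV"
    and \<nu>s: "\<And>n. n \<ge> 1 \<Longrightarrow> prob_space (\<nu>s n)" "\<And>n. sets (\<nu>s n) = sets borel"
    and \<nu>: "prob_space \<nu>" "sets \<nu> = sets borel"
    and conv: "\<And>ps. ps \<in> lists (D \<times> UNIV) \<Longrightarrow>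
      (\<lambda>n. integral\<^sup>L (\<nu>s n) (max_tents ps)) \<longlonglongrightarrow> integral\<^sup>L \<nu> (max_tents ps)"
  shows "weak_conv_fm \<nu>s \<nu>"
proof -
  have lower: "\<forall>\<^sub>F n in sequentially. integral\<^sup>L \<nu> f - \<epsilon> < integral\<^sup>L (\<nu>s n) f"
    if f: "continuous_on UNIV f" "\<And>x. 0 \<le> f x" "\<And>x. f x \<le> B" and "\<epsilon> > 0" for f :: "'a \<Rightarrow> real" and \<epsilon> B
  proof -
    from max_tents_exhaust[OF f(1,2) D] obtain ps where ps: "\<And>n. ps n \<in> lists (D \<times> UNIV)"
      "\<And>n x. max_tents (ps n) x \<le> f x" "\<And>x. (\<lambda>n. max_tents (ps n) x) \<longlonglongrightarrow> f x" by blast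
    interpret \<nu>: prob_space \<nu> by fact
    have bd: "\<bar>f x\<bar> \<le> B" "\<bar>max_tents qs x\<bar> \<le> B" if "\<And>y. max_tents qs y \<le> f y" for x qs
      using f(2)[of x] f(3)[of x] max_tents_nonneg[of qs x] that[of x] by linarith+
    have "(\<lambda>i. integral\<^sup>L \<nu> (max_tents (ps i))) \<longlonglongrightarrow> integral\<^sup>L \<nu> f"
    proof (rule integral_dominated_convergence[where w = "\<lambda>_. B"])
      show "f \<in> borel_measurable \<nu>" "\<And>i. max_tents (ps i) \<in> borel_measurable \<nu>"
        using borel_measurable_continuous_onI[OF f(1)]
          borel_measurable_continuous_onI[OF continuous_on_max_tents]
          measurable_cong_sets[OF \<nu>(2) refl] by blast+
    qed (use ps(3) bd(2)[OF ps(2)] in auto)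
    from order_tendstoD(1)[OF this, of "integral\<^sup>L \<nu> f - \<epsilon>"] \<open>\<epsilon> > 0\<close> obtain i where
      i: "integral\<^sup>L \<nu> f - \<epsilon> < integral\<^sup>L \<nu> (max_tents (ps i))"
      by (auto simp: eventually_sequentially)
    from order_tendstoD(1)[OF conv[OF ps(1)] i] eventually_ge_at_top[of "1::nat"]
    show ?thesis
    proof eventually_elim
      case (elim n)
      have "integral\<^sup>L (\<nu>s n) (max_tents (ps i)) \<le> integral\<^sup>L (\<nu>s n) f"
      proof (rule integral_mono)
        show "integrable (\<nu>s n) (max_tents (ps i))"
          by (rule integrable_bounded_continuous[OF \<nu>s(1)[OF elim(2)] \<nu>s(2) continuous_on_max_tents])
            (rule bd(2)[OF ps(2)])
        show "integrable (\<nu>s n) f"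
          by (rule integrable_bounded_continuous[OF \<nu>s(1)[OF elim(2)] \<nu>s(2) f(1)]) (rule bd(1)[OF ps(2)])
      qed (rule ps(2))
      with elim show ?case by linarith
    qed
  qed
  show ?thesis
    unfolding weak_conv_fm_def
  proof (intro allI impI)
    fix f :: "'a \<Rightarrow> real" assume f: "continuous_on UNIV f \<and> bounded (range f)"
    then obtain B where B: "\<And>x. \<bar>f x\<bar> \<le> B" unfolding bounded_iff by auto
    have B': "0 \<le> B + f x" "0 \<le> B - f x" "B + f x \<le> 2 * B" "B - f x \<le> 2 * B" for x
      using B[of x] by linarith+
    have int: "integrable N f" if "prob_space N" "sets N = sets borel" for N :: "'a measure"
      using integrable_bounded_continuous[OF that, of f] f B by blast
    \<comment> \<open>Here total mass one is used on both sides. It turns two lower bounds into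
      convergence, and it excludes loss of mass at infinity, which functions of bounded support
      cannot see.\<close>
    have eqs: "(\<integral>x. B + f x \<partial>N) = B + integral\<^sup>L N f" "(\<integral>x. B - f x \<partial>N) = B - integral\<^sup>L N f"
      if N: "prob_space N" "sets N = sets borel" for N :: "'a measure"
    proof -
      interpret prob_space N by fact
      show "(\<integral>x. B + f x \<partial>N) = B + integral\<^sup>L N f" "(\<integral>x. B - f x \<partial>N) = B - integral\<^sup>L N f"
        using int[OF N] by (simp_all add: prob_space)
    qed
    show "(\<lambda>n. integral\<^sup>L (\<nu>s n) f) \<longlonglongrightarrow> integral\<^sup>L \<nu> f"
    proof (rule tendstoI)
      fix \<epsilon> :: real assume \<epsilon>: "\<epsilon> > 0"
      have "continuous_on UNIV (\<lambda>x. B + f x)" "continuous_on UNIV (\<lambda>x. B - f x)"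
        using f by (auto intro!: continuous_intros)
      from lower[OF this(1) B'(1,3) \<epsilon>] lower[OF this(2) B'(2,4) \<epsilon>] eventually_ge_at_top[of "1::nat"]
      show "\<forall>\<^sub>F n in sequentially. dist (integral\<^sup>L (\<nu>s n) f) (integral\<^sup>L \<nu> f) < \<epsilon>"
      proof eventually_elim
        case (elim n)
        then show ?case
          unfolding eqs[OF \<nu>] eqs[OF \<nu>s(1)[OF elim(3)] \<nu>s(2)] dist_real_def by linarith
      qed
    qed
  qed
qed

section \<open>The averaging operators\<close>

definition bounded_borel :: "real \<Rightarrow> ('a::euclidean_space \<Rightarrow> real) \<Rightarrow> bool" where
  "bounded_borel C g \<longleftrightarrow> g \<in> borel_measurable borel \<and> (\<forall>x. \<bar>g x\<bar> \<le> C)"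

lemma bounded_borelD:
  assumes "bounded_borel C g"
  shows "g \<in> borel_measurable borel" "\<bar>g x\<bar> \<le> C"
  using assms by (auto simp: bounded_borel_def)

locale step_law = prob_space D for D :: "'d::euclidean_space measure" +
  assumes sets_D [measurable_cong, simp]: "sets D = sets borel"
begin

definition P :: "('d \<Rightarrow> real) \<Rightarrow> 'd \<Rightarrow> real" where
  "P g x = (\<integral>y. g (x + y) \<partial>D)"

text \<open>A uniform node among \<open>k + 1\<close> is an old one with probability
  \<open>k / (k + 1)\<close>; otherwise it is the newest, which sits one step from a uniform old
  node.\<close>

definition Q :: "nat \<Rightarrow> ('d \<Rightarrow> real) \<Rightarrow> 'd \<Rightarrow> real" where
  "Q k g x = (real k * g x + P g x) / real (Suc k)"

text \<open>\<open>H m l g\<close> is the conditional expectation of \<open>g\<close> at a uniform node of the tree of size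
  \<open>m + l\<close>, as a function of the position of its ancestor in the tree of size \<open>m\<close>.\<close>

primrec H :: "nat \<Rightarrow> nat \<Rightarrow> ('d \<Rightarrow> real) \<Rightarrow> 'd \<Rightarrow> real" where
  "H m 0 g = g"
| "H m (Suc l) g = Q m (H (Suc m) l g)"

lemma bounded_borel_shift:
  assumes "bounded_borel C g"
  shows "bounded_borel C (\<lambda>y. g (x + y))"
  using assms unfolding bounded_borel_def by auto

lemma integrable_bounded_borel:
  assumes "bounded_borel C g"
  shows "integrable D g"
  using bounded_borelD[OF assms] by (intro integrable_const_bound[of _ C]) auto

lemma integrable_shift:
  assumes "bounded_borel C g"
  shows "integrable D (\<lambda>y. g (x + y))"
  by (rule integrable_bounded_borel[OF bounded_borel_shift[OF assms]])

lemma integral_const_bounds: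
  fixes a b :: real
  assumes "integrable D h" "\<And>y. a \<le> h y" "\<And>y. h y \<le> b"
  shows "a \<le> (\<integral>y. h y \<partial>D)" "(\<integral>y. h y \<partial>D) \<le> b"
proof -
  have "(\<integral>y. a \<partial>D) \<le> (\<integral>y. h y \<partial>D)"
    by (rule integral_mono) (use assms in auto)
  moreover have "(\<integral>y. h y \<partial>D) \<le> (\<integral>y. b \<partial>D)"
    by (rule integral_mono) (use assms in auto)
  ultimately show "a \<le> (\<integral>y. h y \<partial>D)" "(\<integral>y. h y \<partial>D) \<le> b" by (simp_all add: prob_space)
qed

lemma bounded_borel_P:
  assumes "bounded_borel C g"
  shows "bounded_borel C (P g)"
  unfolding bounded_borel_def
proof (intro conjI allI)
  note bounded_borelD(1)[OF assms, measurable]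
  show "P g \<in> borel_measurable borel"
    unfolding P_def[abs_def] by measurable
  have b: "- C \<le> g z" "g z \<le> C" for z using bounded_borelD(2)[OF assms, of z] by linarith+
  show "\<bar>P g x\<bar> \<le> C" for x
    using integral_const_bounds[OF integrable_shift[OF assms], of "- C" x C] b
    unfolding P_def by (auto simp: abs_le_iff)
qed

lemma bounded_borel_Q:
  assumes "bounded_borel C g"
  shows "bounded_borel C (Q k g)"
  unfolding bounded_borel_def
proof (intro conjI allI)
  note bounded_borelD(1)[OF assms, measurable] bounded_borelD(1)[OF bounded_borel_P[OF assms], measurable]
  show "Q k g \<in> borel_measurable borel"
    unfolding Q_def[abs_def] by measurable
  fix x
  have "\<bar>real k * g x + P g x\<bar> \<le> real k * C + C"
    using mult_left_mono[OF bounded_borelD(2)[OF assms, of x], of "real k"]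
      bounded_borelD(2)[OF bounded_borel_P[OF assms], of x]
    by (intro order_trans[OF abs_triangle_ineq] add_mono) (auto simp: abs_mult)
  then show "\<bar>Q k g x\<bar> \<le> C"
    by (simp add: Q_def field_simps)
qed

lemma bounded_borel_H: "bounded_borel C g \<Longrightarrow> bounded_borel C (H m l g)"
  by (induction l arbitrary: m) (auto intro: bounded_borel_Q)

lemma bounded_borel_P_pow: "bounded_borel C g \<Longrightarrow> bounded_borel C ((P ^^ j) g)"
  by (induction j) (auto intro: bounded_borel_P)

lemma P_mono:
  assumes "bounded_borel C g" "bounded_borel C' h" "\<And>x. g x \<le> h x"
  shows "P g x \<le> P h x"
  unfolding P_def using assms by (intro integral_mono integrable_shift) auto

lemma P_Q:
  assumes "bounded_borel C g"
  shows "P (Q m g) = (\<lambda>x. (real m * P g x + P (P g) x) / real (Suc m))"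
proof
  fix x
  show "P (Q m g) x = (real m * P g x + P (P g) x) / real (Suc m)"
    using integrable_shift[OF assms, of x] integrable_shift[OF bounded_borel_P[OF assms], of x]
    by (simp add: P_def[of "Q m g"] P_def[of g x] P_def[of "P g"] Q_def)
qed

text \<open>\<open>Q m\<close> is a linear polynomial in \<open>P\<close> and so commutes with its
  powers.\<close>

lemma P_pow_Q:
  assumes "bounded_borel C g"
  shows "(P ^^ j) (Q m g) x = (real m * (P ^^ j) g x + (P ^^ Suc j) g x) / real (Suc m)"
proof -
  have "(P ^^ j) (Q m g) = Q m ((P ^^ j) g)"
  proof (induction j)
    case (Suc j)
    have "(P ^^ Suc j) (Q m g) = P (Q m ((P ^^ j) g))" by (simp add: Suc)
    also have "\<dots> = Q m ((P ^^ Suc j) g)"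
      by (subst P_Q[OF bounded_borel_P_pow[OF assms]]) (auto simp: Q_def fun_eq_iff)
    finally show ?case .
  qed simp
  then show ?thesis by (simp add: Q_def)
qed

text \<open>The depth of a uniform node below its ancestor is a sum of independent Bernoulli variables
  with parameters \<open>1 / (k + 1)\<close>; the quadratic error term is its second moment around \<open>L\<close>, so this
  is Chebyshev's inequality for the depth.\<close>

lemma H_quadratic_error:
  assumes g: "bounded_borel B g"
    and err: "\<And>j. \<bar>(P ^^ j) g x - c\<bar> \<le> e + C * (real j - L)\<^sup>2" and "C \<ge> 0"
  shows "\<bar>(P ^^ j) (H m l g) x - c\<bar> \<le> e + C * ((real j + (\<Sum>k=m..<m+l. 1 / real (Suc k)) - L)\<^sup>2
           + (\<Sum>k=m..<m+l. 1 / real (Suc k)))"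
proof (induction l arbitrary: m j)
  case 0
  then show ?case using err by simp
next
  case (Suc l)
  define \<mu> where "\<mu> = (\<Sum>k=Suc m..<Suc m+l. 1 / real (Suc k))"
  define p where "p = 1 / real (Suc m)"
  let ?h = "H (Suc m) l g"
  have p: "0 \<le> p" "p \<le> 1" "real m / real (Suc m) = 1 - p"
    by (auto simp: p_def field_simps)
  have \<mu>': "(\<Sum>k=m..<m + Suc l. 1 / real (Suc k)) = p + \<mu>"
    by (simp add: \<mu>_def p_def sum.atLeast_Suc_lessThan del: of_nat_Suc)
  have eq: "(P ^^ j) (H m (Suc l) g) x - c = (1 - p) * ((P ^^ j) ?h x - c) + p * ((P ^^ Suc j) ?h x - c)"
  proof -
    have "(P ^^ j) (H m (Suc l) g) x = (1 - p) * (P ^^ j) ?h x + p * (P ^^ Suc j) ?h x"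
      unfolding H.simps P_pow_Q[OF bounded_borel_H[OF g]] p(3)[symmetric]
      by (simp add: p_def add_divide_distrib del: of_nat_Suc funpow.simps)
    then show ?thesis by (simp add: algebra_simps del: H.simps funpow.simps)
  qed
  have "\<bar>(P ^^ j) (H m (Suc l) g) x - c\<bar>
      \<le> (1 - p) * \<bar>(P ^^ j) ?h x - c\<bar> + p * \<bar>(P ^^ Suc j) ?h x - c\<bar>"
    unfolding eq using p by (intro order_trans[OF abs_triangle_ineq]) (simp add: abs_mult)
  also have "\<dots> \<le> (1 - p) * (e + C * ((real j + \<mu> - L)\<^sup>2 + \<mu>)) + p * (e + C * ((real (Suc j) + \<mu> - L)\<^sup>2 + \<mu>))"
    using p Suc[of j "Suc m"] Suc[of "Suc j" "Suc m"] unfolding \<mu>_def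
    by (intro add_mono mult_left_mono) auto
  \<comment> \<open>One Bernoulli variable shifts the mean by \<open>p\<close> and adds variance
    \<open>p - p^2\<close>. The square is given away, so that the sum of the parameters bounds the
    variance.\<close>
  also have "\<dots> = e + C * ((real j + (p + \<mu>) - L)\<^sup>2 + (p + \<mu>)) - C * p\<^sup>2"
    by (simp add: algebra_simps power2_eq_square)
  also have "\<dots> \<le> e + C * ((real j + (p + \<mu>) - L)\<^sup>2 + (p + \<mu>))"
    using \<open>C \<ge> 0\<close> by simp
  finally show ?case unfolding \<mu>' .
qed

text \<open>The displacement \<open>x\<close> is fixed and the bound is uniform in \<open>z\<close>,
  so it survives averaging over a step and convex combination, the only operations in
  \<open>H\<close>.\<close>

lemma H_shift_bound:
  assumes g: "bounded_borel B g" and sh: "\<And>z. \<bar>g (x + z) - g z\<bar> \<le> b"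
  shows "\<bar>H m l g (x + z) - H m l g z\<bar> \<le> b"
proof (induction l arbitrary: m z)
  case 0
  then show ?case using sh by simp
next
  case (Suc l)
  let ?h = "H (Suc m) l g"
  note h = bounded_borel_H[OF g, of "Suc m" l]
  have h_sh: "- b \<le> ?h (x + z) - ?h z" "?h (x + z) - ?h z \<le> b" for z
    using Suc[of "Suc m" z] by linarith+
  have eq: "P ?h (x + z) - P ?h z = (\<integral>y. ?h (x + (z + y)) - ?h (z + y) \<partial>D)"
    using integrable_shift[OF h, of "x + z"] integrable_shift[OF h, of z]
    by (simp add: P_def add.assoc)
  have int: "integrable D (\<lambda>y. ?h (x + (z + y)) - ?h (z + y))"
    using integrable_shift[OF h, of "x + z"] integrable_shift[OF h, of z] by (simp add: add.assoc)
  have Pb: "\<bar>P ?h (x + z) - P ?h z\<bar> \<le> b"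
    unfolding eq using integral_const_bounds[OF int, of "- b" b] h_sh by (auto simp: abs_le_iff)
  have "H m (Suc l) g (x + z) - H m (Suc l) g z
      = (real m * (?h (x + z) - ?h z) + (P ?h (x + z) - P ?h z)) / real (Suc m)"
    by (simp add: Q_def diff_divide_distrib add_divide_distrib algebra_simps)
  also have "\<bar>\<dots>\<bar> \<le> (real m * b + b) / real (Suc m)"
    using mult_left_mono[OF Suc[of "Suc m" z], of "real m"] Pb
    unfolding abs_divide
    by (intro divide_mono order_trans[OF abs_triangle_ineq] add_mono) (auto simp: abs_mult)
  also have "\<dots> = b" by (simp add: field_simps)
  finally show ?case .
qed

text \<open>Ottaviani's inequality for the exit of the walk from the ball of radius \<open>2 c\<close>, which any step
  longer than \<open>4 c\<close> forces.\<close>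

lemma P_pow_large_lower:
  fixes c \<eta> :: real
  defines "g \<equiv> indicat_real {x. c < norm x}" and "p \<equiv> measure D {y. 4 * c < norm y}"
  assumes small: "\<And>j. j \<le> k \<Longrightarrow> (P ^^ j) (indicat_real {x. norm x \<le> c}) 0 \<ge> 1 - \<eta>" and "\<eta> \<le> 1"
    and x: "norm x \<le> 2 * c"
  shows "(P ^^ k) g x \<ge> (1 - \<eta>) * (1 - (1 - p) ^ k)"
  using small x
proof (induction k arbitrary: x)
  case 0
  then show ?case by (simp add: g_def)
next
  case (Suc k)
  have p: "0 \<le> p" "p \<le> 1" unfolding p_def by auto
  let ?s = "indicat_real {x. norm x \<le> c}"
  have g: "bounded_borel 1 g" unfolding g_def bounded_borel_def by (auto simp: indicator_def)
  have s: "bounded_borel 1 ?s" unfolding bounded_borel_def by (auto simp: indicator_def)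
  note gk = bounded_borel_P_pow[OF g, of k]
  define q where "q = (1 - \<eta>) * (1 - (1 - p) ^ k)"
  have "0 \<le> (1 - p) ^ k" using p by simp
  then have q_le: "q \<le> 1 - \<eta>" using \<open>\<eta> \<le> 1\<close> unfolding q_def by (simp add: mult_left_le)
  have shift: "(P ^^ j) f (z + w) = (P ^^ j) (\<lambda>y. f (z + y)) w" for j f and z w :: 'd
    by (induction j arbitrary: w) (auto simp: P_def add.assoc)
  \<comment> \<open>Once outside the ball of radius \<open>2 * c\<close>, the walk ends outside
    radius \<open>c\<close> unless its remaining displacement exceeds \<open>c\<close>, which has
    probability at most \<eta>.\<close>
  have far: "(P ^^ k) g z \<ge> 1 - \<eta>" if "norm z > 2 * c" for z
  proof -
    have le: "?s y \<le> g (z + y)" for y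
      using that norm_triangle_ineq2[of z "- y"] unfolding g_def by (auto simp: indicator_def)
    have "(P ^^ j) ?s y \<le> (P ^^ j) (\<lambda>y. g (z + y)) y" for j y
    proof (induction j arbitrary: y)
      case (Suc j)
      show ?case
        using P_mono[OF bounded_borel_P_pow[OF s] bounded_borel_P_pow[OF bounded_borel_shift[OF g]] Suc]
        by simp
    qed (simp add: le)
    from this[of k 0] shift[of k g z 0] Suc.prems(1)[of k] show ?thesis by simp
  qed
  have near: "(P ^^ k) g z \<ge> q" if "norm z \<le> 2 * c" for z
    using Suc.IH[of z] Suc.prems(1) that unfolding q_def by auto
  have ind: "(\<lambda>y. indicat_real {y. 4 * c < norm y} y) \<in> borel_measurable D" by measurable
  \<comment> \<open>Split by the next step. With probability \<open>p\<close> it is longer than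
    \<open>4 * c\<close> and leads out of the ball, where the bound is \<open>1 - \<eta>\<close>;
    otherwise the weaker bound \<open>q\<close> holds wherever the walk lands.\<close>
  have "(1 - \<eta>) * (1 - (1 - p) ^ Suc k) = q + p * (1 - \<eta> - q)"
    by (simp add: q_def algebra_simps)
  also have "\<dots> = (\<integral>y. q + (1 - \<eta> - q) * indicat_real {y. 4 * c < norm y} y \<partial>D)"
  proof -
    have "integrable D (\<lambda>y. indicat_real {y. 4 * c < norm y} y)"
      by (rule integrable_real_indicator) (auto simp: emeasure_eq_measure)
    then show ?thesis by (simp add: p_def prob_space)
  qed
  also have "\<dots> \<le> (\<integral>y. (P ^^ k) g (x + y) \<partial>D)"
  proof (rule integral_mono)
    show "integrable D (\<lambda>y. q + (1 - \<eta> - q) * indicat_real {y. 4 * c < norm y} y)"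
      by (intro Bochner_Integration.integrable_add integrable_mult_right integrable_real_indicator)
        (auto simp: emeasure_eq_measure)
    show "integrable D (\<lambda>y. (P ^^ k) g (x + y))" by (rule integrable_shift[OF gk])
    fix y
    show "q + (1 - \<eta> - q) * indicat_real {y. 4 * c < norm y} y \<le> (P ^^ k) g (x + y)"
    proof (cases "4 * c < norm y")
      case True
      then have "norm (x + y) > 2 * c"
        using Suc.prems(2) norm_triangle_ineq2[of y "- x"] by (auto simp: add.commute)
      from far[OF this] show ?thesis by (simp add: True)
    next
      case False
      then show ?thesis
        using far[of "x + y"] near[of "x + y"] q_le by (cases "norm (x + y) > 2 * c") auto
    qed
  qed
  also have "\<dots> = (P ^^ Suc k) g x" by (simp add: P_def)
  finally show ?case .
qed

end

section \<open>The martingale of averages\<close>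

lemma abs_mult_le:
  fixes x y :: real
  assumes "\<bar>x\<bar> \<le> a" "\<bar>y\<bar> \<le> b"
  shows "\<bar>x * y\<bar> \<le> a * b"
proof -
  have "0 \<le> a" using assms(1) by linarith
  then show ?thesis unfolding abs_mult using assms by (intro mult_mono) auto
qed

text \<open>Fubini for the product law of \<open>X\<close> and \<open>Y\<close>, pulled back to
  \<open>M\<close>: the value of \<open>X\<close> is frozen while an independent copy of
  \<open>Y\<close> is integrated out.\<close>

lemma (in prob_space) indep_var_integral:
  assumes ind: "indep_var N1 X N2 Y" and F: "F \<in> borel_measurable (N1 \<Otimes>\<^sub>M N2)"
    and bd: "\<And>x y. \<bar>F (x, y) :: real\<bar> \<le> B"
  shows "expectation (\<lambda>\<omega>. F (X \<omega>, Y \<omega>)) = expectation (\<lambda>\<omega>. \<integral>\<omega>'. F (X \<omega>, Y \<omega>') \<partial>M)"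
proof -
  note rv = indep_var_rv1[OF ind] indep_var_rv2[OF ind]
  interpret D1: prob_space "distr M N1 X" using rv(1) by (rule prob_space_distr)
  interpret D2: prob_space "distr M N2 Y" using rv(2) by (rule prob_space_distr)
  interpret D: pair_prob_space "distr M N1 X" "distr M N2 Y" ..
  have [measurable]: "X \<in> measurable M N1" "Y \<in> measurable M N2" "F \<in> borel_measurable (N1 \<Otimes>\<^sub>M N2)"
    using rv F by auto
  have "expectation (\<lambda>\<omega>. F (X \<omega>, Y \<omega>)) = integral\<^sup>L (distr M (N1 \<Otimes>\<^sub>M N2) (\<lambda>\<omega>. (X \<omega>, Y \<omega>))) F"
    by (subst integral_distr) auto
  also have "distr M (N1 \<Otimes>\<^sub>M N2) (\<lambda>\<omega>. (X \<omega>, Y \<omega>)) = distr M N1 X \<Otimes>\<^sub>M distr M N2 Y"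
    using indep_var_distribution_eq[of N1 X N2 Y] ind by simp
  also have "integral\<^sup>L (distr M N1 X \<Otimes>\<^sub>M distr M N2 Y) F
      = (\<integral>x. (\<integral>y. F (x, y) \<partial>distr M N2 Y) \<partial>distr M N1 X)"
  proof (rule D.integral_fst'[symmetric])
    show "integrable (distr M N1 X \<Otimes>\<^sub>M distr M N2 Y) F"
      by (rule D.integrable_const_bound[of _ B]) (use bd in \<open>auto simp: case_prod_beta\<close>)
  qed
  also have "\<dots> = expectation (\<lambda>\<omega>. \<integral>y. F (X \<omega>, y) \<partial>distr M N2 Y)"
    by (subst integral_distr) auto
  also have "\<dots> = expectation (\<lambda>\<omega>. \<integral>\<omega>'. F (X \<omega>, Y \<omega>') \<partial>M)"
  proof (rule Bochner_Integration.integral_cong)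
    fix \<omega> assume "\<omega> \<in> space M"
    then have [measurable]: "X \<omega> \<in> space N1" using measurable_space[OF rv(1)] by simp
    show "(\<integral>y. F (X \<omega>, y) \<partial>distr M N2 Y) = (\<integral>\<omega>'. F (X \<omega>, Y \<omega>') \<partial>M)"
      by (subst integral_distr) auto
  qed simp
  finally show ?thesis .
qed

lemma Int_stable_vimage: "Int_stable {X -` A \<inter> S | A. A \<in> sets N}"
proof (rule Int_stableI)
  fix a b assume "a \<in> {X -` A \<inter> S | A. A \<in> sets N}" "b \<in> {X -` A \<inter> S | A. A \<in> sets N}"
  then obtain A B where "A \<in> sets N" "B \<in> sets N" "a = X -` A \<inter> S" "b = X -` B \<inter> S"
    by auto
  then show "a \<inter> b \<in> {X -` A \<inter> S | A. A \<in> sets N}"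
    by (intro CollectI exI[of _ "A \<inter> B"]) auto
qed

locale random_recursive_walk = prob_space M for M :: "'s measure" +
  fixes \<Delta> :: "nat \<Rightarrow> 's \<Rightarrow> 'd::euclidean_space" and U :: "nat \<Rightarrow> 's \<Rightarrow> nat"
  assumes meas_\<Delta>: "i \<ge> 1 \<Longrightarrow> \<Delta> i \<in> borel_measurable M"
    and ident: "i \<ge> 1 \<Longrightarrow> distr M borel (\<Delta> i) = distr M borel (\<Delta> 1)"
    and meas_U: "n \<ge> 2 \<Longrightarrow> U n \<in> measurable M (count_space UNIV)"
    and unif: "n \<ge> 2 \<Longrightarrow>
        distr M (count_space UNIV) (U n) = uniform_measure (count_space UNIV) {1..n-1}"
    and indep: "indep_sets
        (\<lambda>j. case j of
               Inl i \<Rightarrow> {\<Delta> i -` A \<inter> space M | A. A \<in> sets borel}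
             | Inr n \<Rightarrow> {U n -` A \<inter> space M | A. A \<in> sets (count_space UNIV)})
        (Inl ` {1..} \<union> Inr ` {2..})"
begin

section \<open>Independence of the sigma-algebras generated by disjoint sets of variables\<close>

abbreviation \<E> :: "nat + nat \<Rightarrow> 's set set" where
  "\<E> j \<equiv> (case j of
               Inl i \<Rightarrow> {\<Delta> i -` A \<inter> space M | A. A \<in> sets borel}
             | Inr n \<Rightarrow> {U n -` A \<inter> space M | A. A \<in> sets (count_space UNIV)})"

abbreviation indices :: "(nat + nat) set" where
  "indices \<equiv> Inl ` {1..} \<union> Inr ` {2..}"

text \<open>Only the space and the sets of this measure matter: it is the domain in statements of
  measurability with respect to the variables indexed by \<open>J\<close>.\<close>

definition sig :: "(nat + nat) set \<Rightarrow> 's measure" where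
  "sig J = sigma (space M) (\<Union>j\<in>J. \<E> j)"

lemma events_Pow: "(\<Union>j\<in>J. \<E> j) \<subseteq> Pow (space M)"
  by (auto split: sum.splits)

lemma space_sig [simp]: "space (sig J) = space M"
  unfolding sig_def by (rule space_measure_of[OF events_Pow])

lemma sets_sig: "sets (sig J) = sigma_sets (space M) (\<Union>j\<in>J. \<E> j)"
  unfolding sig_def by (rule sets_measure_of[OF events_Pow])

lemma sets_sig_mono: "J \<subseteq> J' \<Longrightarrow> sets (sig J) \<subseteq> sets (sig J')"
  unfolding sets_sig by (rule sigma_sets_mono') auto

lemma measurable_sig_mono:
  assumes "J \<subseteq> J'" "f \<in> measurable (sig J) N"
  shows "f \<in> measurable (sig J') N"
  using assms(2) sets_sig_mono[OF assms(1)] by (auto simp: measurable_def)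

lemma sets_sig_events:
  assumes "J \<subseteq> indices"
  shows "sets (sig J) \<subseteq> events"
  unfolding sets_sig
proof (rule sigma_sets_le_sets_iff[THEN iffD2])
  have "\<E> j \<subseteq> events" if "j \<in> indices" for j
    using indep that unfolding indep_sets_def by blast
  then show "(\<Union>j\<in>J. \<E> j) \<subseteq> events" using assms by blast
qed

lemma measurable_sig_M:
  assumes "J \<subseteq> indices" "f \<in> measurable (sig J) N"
  shows "f \<in> measurable M N"
  using assms(2) sets_sig_events[OF assms(1)] by (auto simp: measurable_def)

lemma measurable_sig_\<Delta>: "Inl i \<in> J \<Longrightarrow> \<Delta> i \<in> borel_measurable (sig J)"
  by (rule measurableI) (force simp: sets_sig intro!: sigma_sets.Basic bexI[of _ "Inl i"])+

lemma measurable_sig_U: "Inr n \<in> J \<Longrightarrow> U n \<in> measurable (sig J) (count_space UNIV)"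
  by (rule measurableI) (force simp: sets_sig intro!: sigma_sets.Basic bexI[of _ "Inr n"])+

text \<open>The generating classes are stable under intersection, so independence passes from single
  indices to the sigma-algebras of disjoint index sets and to whatever is measurable for
  them.\<close>

lemma indep_var_sig:
  assumes J: "J1 \<subseteq> indices" "J2 \<subseteq> indices" "J1 \<inter> J2 = {}"
    and f: "f \<in> measurable (sig J1) N1" "g \<in> measurable (sig J2) N2"
  shows "indep_var N1 f N2 g"
proof -
  have "indep_sets (\<lambda>b. sigma_sets (space M) (\<Union>i\<in>case_bool J1 J2 b. \<E> i)) UNIV"
  proof (rule indep_sets_collect_sigma)
    show "indep_sets \<E> (\<Union>b\<in>UNIV. case_bool J1 J2 b)"
      by (rule indep_sets_mono_index[OF _ indep]) (use J in \<open>auto split: bool.splits\<close>)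
    show "disjoint_family_on (case_bool J1 J2) UNIV"
      using J(3) by (auto simp: disjoint_family_on_def split: bool.splits)
    show "Int_stable (\<E> j)" for j
      by (cases j) (simp_all only: sum.case Int_stable_vimage)
  qed
  then have ind: "indep_set (sets (sig J1)) (sets (sig J2))"
    unfolding indep_set_def sets_sig by (rule indep_sets_mono_sets) (auto split: bool.splits)
  have sub: "sigma_sets (space M) {h -` A \<inter> space M |A. A \<in> sets N} \<subseteq> sets (sig J)"
    if h: "h \<in> measurable (sig J) N" for h :: "'s \<Rightarrow> 'x" and N J
  proof -
    have "{h -` A \<inter> space M |A. A \<in> sets N} \<subseteq> sets (sig J)"
      using measurable_sets[OF h] by auto
    then show ?thesis using sets.sigma_sets_subset[of _ "sig J"] by simp
  qed
  show ?thesis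
    unfolding indep_var_eq
  proof (intro conjI)
    show "random_variable N1 f" "random_variable N2 g"
      using measurable_sig_M J f by auto
    show "indep_set (sigma_sets (space M) {f -` A \<inter> space M |A. A \<in> sets N1})
        (sigma_sets (space M) {g -` A \<inter> space M |A. A \<in> sets N2})"
      using ind sub[OF f(1)] sub[OF f(2)] unfolding indep_sets2_eq by blast
  qed
qed

text \<open>The measurable version of \<open>X\<close>; the two agree almost surely, namely where every \<open>U n\<close> takes a
  value in \<open>{1..n - 1}\<close>.\<close>

function pos :: "nat \<Rightarrow> 's \<Rightarrow> 'd" where
  "pos n \<omega> = (if 2 \<le> n \<and> U n \<omega> \<in> {1..n-1} then pos (U n \<omega>) \<omega> + \<Delta> n \<omega> else \<Delta> n \<omega>)"
  by auto
termination by (relation "Wellfounded.measure fst") auto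

declare pos.simps [simp del]

text \<open>\<open>sig (past k)\<close> is the natural filtration of the tree and its positions. The
  \<open>Inr\<close> part starts at 2 because the root chooses no parent.\<close>

definition past :: "nat \<Rightarrow> (nat + nat) set" where
  "past k = Inl ` {1..k} \<union> Inr ` {2..k}"

lemma past_indices: "past k \<subseteq> indices"
  by (auto simp: past_def)

lemma past_mono: "k \<le> k' \<Longrightarrow> past k \<subseteq> past k'"
  by (auto simp: past_def)

lemma pos_past:
  assumes "1 \<le> i" "i \<le> k"
  shows "pos i \<in> borel_measurable (sig (past k))"
  using assms
proof (induction i rule: less_induct)
  case (less i)
  have [measurable]: "\<Delta> i \<in> borel_measurable (sig (past k))"
    using less.prems by (intro measurable_sig_\<Delta>) (auto simp: past_def)
  show ?case
  proof (cases "2 \<le> i")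
    case True
    then have [measurable]: "U i \<in> measurable (sig (past k)) (count_space UNIV)"
      using less.prems by (intro measurable_sig_U) (auto simp: past_def)
    have [measurable]: "pos u \<in> borel_measurable (sig (past k))" if "u \<in> {1..i-1}" for u
      using less.IH[of u] less.prems that by auto
    \<comment> \<open>A position at a random index is measurable because the index has finitely many
      relevant values. If \<open>U i\<close> is out of range the sum is 0, in agreement with the
      default branch of \<open>pos\<close>.\<close>
    have "pos i \<omega> = \<Delta> i \<omega> + (\<Sum>u\<in>{1..i-1}. if U i \<omega> = u then pos u \<omega> else 0)" for \<omega>
      using True by (subst pos.simps) (auto simp: sum.delta')
    then have "pos i = (\<lambda>\<omega>. \<Delta> i \<omega> + (\<Sum>u\<in>{1..i-1}. if U i \<omega> = u then pos u \<omega> else 0))" ..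
    also have "\<dots> \<in> borel_measurable (sig (past k))" by measurable
    finally show ?thesis .
  next
    case False
    then have "pos i = \<Delta> i" by (subst pos.simps[abs_def]) auto
    then show ?thesis by simp
  qed
qed

lemma measurable_pos: "1 \<le> i \<Longrightarrow> pos i \<in> borel_measurable M"
  using measurable_sig_M[OF past_indices pos_past[of i i]] by simp

lemma pos_1: "pos 1 \<omega> = \<Delta> 1 \<omega>"
  by (subst pos.simps) simp

lemma prob_U:
  assumes "n \<ge> 2"
  shows "expectation (\<lambda>\<omega>. h (U n \<omega>)) = (\<Sum>u=1..n-1. h u :: real) / real (n - 1)"
proof -
  have "expectation (\<lambda>\<omega>. h (U n \<omega>)) = integral\<^sup>L (distr M (count_space UNIV) (U n)) h"
    using meas_U[OF assms] by (subst integral_distr) auto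
  also have "distr M (count_space UNIV) (U n)
      = density (count_space UNIV) (\<lambda>u. ennreal (indicat_real {1..n-1} u / real (n - 1)))"
    unfolding unif[OF assms] uniform_measure_def using assms
    by (intro arg_cong[where f = "density _"] ext)
      (auto simp: indicator_def ennreal_of_nat_eq_real_of_nat divide_ennreal simp flip: ennreal_1)
  also have "integral\<^sup>L \<dots> h = (\<integral>u. indicat_real {1..n-1} u / real (n - 1) * h u \<partial>count_space UNIV)"
    by (subst integral_density) auto
  also have "\<dots> = (\<Sum>u | u \<in> UNIV \<and> indicat_real {1..n-1} u / real (n - 1) * h u \<noteq> 0.
      indicat_real {1..n-1} u / real (n - 1) * h u)"
  proof (rule lebesgue_integral_count_space_finite_support)
    have "{u \<in> UNIV. indicat_real {1..n-1} u / real (n - 1) * h u \<noteq> 0} \<subseteq> {1..n-1}"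
      by (auto simp: indicator_def split: if_splits)
    then show "finite {u \<in> UNIV. indicat_real {1..n-1} u / real (n - 1) * h u \<noteq> 0}"
      by (rule finite_subset) simp
  qed
  also have "\<dots> = (\<Sum>u=1..n-1. indicat_real {1..n-1} u / real (n - 1) * h u)"
    by (rule sum.mono_neutral_left) (auto simp: indicator_def split: if_splits)
  also have "\<dots> = (\<Sum>u=1..n-1. h u) / real (n - 1)"
    by (simp add: sum_divide_distrib)
  finally show ?thesis .
qed

lemma AE_U:
  assumes "n \<ge> 2"
  shows "AE \<omega> in M. U n \<omega> \<in> {1..n-1}"
proof -
  note meas_U[OF assms, measurable]
  have "prob {\<omega>\<in>space M. U n \<omega> \<in> {1..n-1}} = expectation (\<lambda>\<omega>. indicat_real {1..n-1} (U n \<omega>))"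
  proof -
    have "expectation (\<lambda>\<omega>. indicat_real {1..n-1} (U n \<omega>))
        = expectation (indicat_real {\<omega>\<in>space M. U n \<omega> \<in> {1..n-1}})"
      by (intro Bochner_Integration.integral_cong) (auto simp: indicator_def)
    then show ?thesis by simp
  qed
  also have "\<dots> = 1"
    using assms by (subst prob_U) (auto simp: indicator_def)
  finally show ?thesis by (subst (asm) prob_Collect_eq_1) auto
qed

definition law :: "'d measure" where
  "law = distr M borel (\<Delta> 1)"

sublocale D: step_law law
  unfolding law_def
  using meas_\<Delta>[of 1] by (intro step_law.intro prob_space_distr step_law_axioms.intro) auto

lemma AE_pos:
  assumes X: "AE \<omega> in M. X 1 \<omega> = \<Delta> 1 \<omega> \<and> (\<forall>n\<ge>2. X n \<omega> = X (U n \<omega>) \<omega> + \<Delta> n \<omega>)"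
  shows "AE \<omega> in M. \<forall>n\<ge>1. X n \<omega> = pos n \<omega>"
proof -
  have "AE \<omega> in M. \<forall>n\<ge>2. U n \<omega> \<in> {1..n-1}"
    unfolding AE_all_countable using AE_U by auto
  with X show ?thesis
  proof eventually_elim
    case (elim \<omega>)
    have "X n \<omega> = pos n \<omega>" if "n \<ge> 1" for n
      using that
    proof (induction n rule: less_induct)
      case (less n)
      show ?case
      proof (cases "n = 1")
        case True
        with elim(1) pos_1 show ?thesis by auto
      next
        case False
        then have n: "n \<ge> 2" "U n \<omega> \<in> {1..n-1}" using less.prems elim(2) by auto
        then have "X (U n \<omega>) \<omega> = pos (U n \<omega>) \<omega>" using less.IH[of "U n \<omega>"] by auto
        then show ?thesis using elim(1) n by (subst pos.simps) auto
      qed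
    qed
    then show ?case by auto
  qed
qed

lemma integral_new_step:
  assumes J: "J \<subseteq> indices" "Inl i \<in> indices" "Inl i \<notin> J"
    and Z: "Z \<in> borel_measurable (sig J)" "\<And>\<omega>. \<bar>Z \<omega>\<bar> \<le> B" and V: "V \<in> borel_measurable (sig J)"
    and g: "bounded_borel C g"
  shows "expectation (\<lambda>\<omega>. Z \<omega> * g (V \<omega> + \<Delta> i \<omega>)) = expectation (\<lambda>\<omega>. Z \<omega> * D.P g (V \<omega>))"
proof -
  have i: "i \<ge> 1" using J(2) by auto
  \<comment> \<open>The integrand has to be bounded at all arguments and not just at values taken by
    \<open>Z\<close>. Clipping achieves this and leaves \<open>Z\<close> unchanged.\<close>
  define clip where "clip z = max (- B) (min B z)" for z :: real
  have clip: "clip (Z \<omega>) = Z \<omega>" "\<bar>clip z\<bar> \<le> \<bar>B\<bar>" for \<omega> z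
    using Z(2)[of \<omega>] by (auto simp: clip_def)
  \<comment> \<open>\<open>indep_var\<close> wants both variables in the same type, hence the dummy \<open>0\<close> next to \<open>\<Delta> i\<close>\<close>
  define F :: "(real \<times> 'd) \<times> (real \<times> 'd) \<Rightarrow> real" where
    "F q = clip (fst (fst q)) * g (snd (fst q) + snd (snd q))" for q
  note Z(1)[measurable] V[measurable] bounded_borelD(1)[OF g, measurable]
  have [measurable]: "\<Delta> i \<in> borel_measurable (sig {Inl i})" by (rule measurable_sig_\<Delta>) simp
  have ind: "indep_var (borel \<Otimes>\<^sub>M borel) (\<lambda>\<omega>. (Z \<omega>, V \<omega>)) (borel \<Otimes>\<^sub>M borel) (\<lambda>\<omega>. (0 :: real, \<Delta> i \<omega>))"
    by (rule indep_var_sig[of J "{Inl i}"]) (use J in auto)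
  have "expectation (\<lambda>\<omega>. F ((Z \<omega>, V \<omega>), (0, \<Delta> i \<omega>)))
      = expectation (\<lambda>\<omega>. \<integral>\<omega>'. F ((Z \<omega>, V \<omega>), (0, \<Delta> i \<omega>')) \<partial>M)"
  proof (rule indep_var_integral[OF ind, of F "\<bar>B\<bar> * C"])
    show "F \<in> borel_measurable ((borel \<Otimes>\<^sub>M borel) \<Otimes>\<^sub>M (borel \<Otimes>\<^sub>M borel))"
      unfolding F_def[abs_def] clip_def[abs_def] by measurable
    show "\<bar>F (x, y)\<bar> \<le> \<bar>B\<bar> * C" for x y
      using abs_mult_le[OF clip(2) bounded_borelD(2)[OF g]]
      by (auto simp: F_def)
  qed
  moreover have "(\<integral>\<omega>'. F ((Z \<omega>, V \<omega>), (0, \<Delta> i \<omega>')) \<partial>M) = Z \<omega> * D.P g (V \<omega>)" for \<omega>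
  proof -
    have "D.P g (V \<omega>) = (\<integral>y. g (V \<omega> + y) \<partial>distr M borel (\<Delta> i))"
      unfolding D.P_def unfolding law_def ident[OF i] ..
    also have "\<dots> = (\<integral>\<omega>'. g (V \<omega> + \<Delta> i \<omega>') \<partial>M)"
      using meas_\<Delta>[OF i] by (subst integral_distr) auto
    finally show ?thesis by (simp add: F_def clip)
  qed
  moreover have "F ((Z \<omega>, V \<omega>), (0, \<Delta> i \<omega>)) = Z \<omega> * g (V \<omega> + \<Delta> i \<omega>)" for \<omega>
    by (simp add: F_def clip)
  ultimately show ?thesis by simp
qed

section \<open>Averages over the first positions and their conditional expectations\<close>

definition avg :: "nat \<Rightarrow> ('d \<Rightarrow> real) \<Rightarrow> 's \<Rightarrow> real" where
  "avg n g \<omega> = (\<Sum>i=1..n. g (pos i \<omega>)) / real n"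

lemma avg_bound: "bounded_borel C g \<Longrightarrow> \<bar>avg n g \<omega>\<bar> \<le> C"
proof -
  assume g: "bounded_borel C g"
  have "\<bar>\<Sum>i=1..n. g (pos i \<omega>)\<bar> \<le> real n * C"
    using order_trans[OF sum_abs sum_bounded_above[of "{1..n}" "\<lambda>i. \<bar>g (pos i \<omega>)\<bar>" C]]
      bounded_borelD(2)[OF g] by auto
  moreover have "C \<ge> 0" using bounded_borelD(2)[OF g, of 0] by linarith
  ultimately show ?thesis by (cases "n = 0") (auto simp: avg_def field_simps)
qed

lemma avg_past:
  assumes "bounded_borel C g" "n \<le> k"
  shows "avg n g \<in> borel_measurable (sig (past k))"
proof -
  have "(\<lambda>\<omega>. g (pos i \<omega>)) \<in> borel_measurable (sig (past k))" if "i \<in> {1..n}" for i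
    using measurable_compose[OF pos_past bounded_borelD(1)[OF assms(1)]] that assms(2) by auto
  then show ?thesis unfolding avg_def[abs_def] by measurable
qed

lemma avg_measurable: "bounded_borel C g \<Longrightarrow> avg n g \<in> borel_measurable M"
  using measurable_sig_M[OF past_indices avg_past] by blast

lemma integrable_bounded:
  assumes "f \<in> borel_measurable M" "\<And>\<omega>. \<bar>f \<omega> :: real\<bar> \<le> B"
  shows "integrable M f"
  using assms by (intro integrable_const_bound[of _ B]) auto

text \<open>With \<open>Z\<close> ranging over bounded variables known at time \<open>k\<close>,
  this is the formula for the conditional expectation of \<open>g\<close> at the newest node, in
  integrated form. The fresh step turns \<open>g\<close> into \<open>P g\<close>, and the uniform
  parent turns \<open>P g\<close> into its average.\<close>

lemma expectation_new_node:
  assumes k: "k \<ge> 1" and Z: "Z \<in> borel_measurable (sig (past k))" "\<And>\<omega>. \<bar>Z \<omega>\<bar> \<le> B"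
    and g: "bounded_borel C g"
  shows "expectation (\<lambda>\<omega>. Z \<omega> * g (pos (Suc k) \<omega>)) = expectation (\<lambda>\<omega>. Z \<omega> * avg k (D.P g) \<omega>)"
proof -
  \<comment> \<open>The step is integrated out first, while the choice of the parent still counts as
    known; the choice is then separated from \<open>past k\<close> by independence.\<close>
  let ?J = "insert (Inr (Suc k)) (past k)"
  have J: "?J \<subseteq> indices" "Inl (Suc k) \<in> indices" "Inl (Suc k) \<notin> ?J"
    using k by (auto simp: past_def)
  have UJ: "U (Suc k) \<in> measurable (sig {Inr (Suc k)}) (count_space UNIV)"
    by (rule measurable_sig_U) auto
  have up: "f \<in> borel_measurable (sig ?J)" if "f \<in> borel_measurable (sig (past k))"
    for f :: "'s \<Rightarrow> 'b::topological_space"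
    by (rule measurable_sig_mono[OF _ that]) auto
  note [measurable] = up[OF Z(1)] measurable_sig_M[OF past_indices Z(1)]
  have PgM: "D.P g \<in> borel_measurable borel" by (rule bounded_borelD(1)[OF D.bounded_borel_P[OF g]])
  define I where "I u \<omega> = indicat_real {u} (U (Suc k) \<omega>)" for u \<omega>
  have IJ: "I u \<in> borel_measurable (sig {Inr (Suc k)})" for u
    unfolding I_def[abs_def] by (rule measurable_compose[OF UJ]) simp
  have [measurable]: "I u \<in> borel_measurable (sig ?J)" "I u \<in> borel_measurable M" for u
    using measurable_sig_mono[OF _ IJ] measurable_sig_M[OF _ IJ] k by auto
  have Ib: "0 \<le> I u \<omega>" "I u \<omega> \<le> 1" for u \<omega> by (auto simp: I_def indicator_def)
  have ZI: "\<bar>Z \<omega> * I u \<omega>\<bar> \<le> B" for u \<omega>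
    using abs_mult_le[OF Z(2)[of \<omega>], of "I u \<omega>" 1] Ib[of u \<omega>] by simp
  have EI: "expectation (I u) = 1 / real k" if "u \<in> {1..k}" for u
    using prob_U[of "Suc k" "indicat_real {u}"] k that unfolding I_def[abs_def]
    by (simp add: indicator_def of_bool_def sum.delta)
  have posM: "pos u \<in> borel_measurable M" if "u \<in> {1..k}" for u
    using measurable_pos that by auto
  have step: "expectation (\<lambda>\<omega>. (Z \<omega> * I u \<omega>) * g (pos u \<omega> + \<Delta> (Suc k) \<omega>))
      = (1 / real k) * expectation (\<lambda>\<omega>. Z \<omega> * D.P g (pos u \<omega>))" if u: "u \<in> {1..k}" for u
  proof -
    have pu: "pos u \<in> borel_measurable (sig (past k))" using u by (intro pos_past) auto
    have "expectation (\<lambda>\<omega>. (Z \<omega> * I u \<omega>) * g (pos u \<omega> + \<Delta> (Suc k) \<omega>))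
        = expectation (\<lambda>\<omega>. (Z \<omega> * I u \<omega>) * D.P g (pos u \<omega>))"
      using up[OF pu] ZI by (intro integral_new_step[OF J _ _ _ g]) auto
    also have "\<dots> = expectation (\<lambda>\<omega>. I u \<omega> * (Z \<omega> * D.P g (pos u \<omega>)))"
      by (simp add: mult_ac)
    also have "\<dots> = expectation (I u) * expectation (\<lambda>\<omega>. Z \<omega> * D.P g (pos u \<omega>))"
    proof (rule indep_var_lebesgue_integral)
      have zp: "(\<lambda>\<omega>. Z \<omega> * D.P g (pos u \<omega>)) \<in> borel_measurable (sig (past k))"
        using Z(1) measurable_compose[OF pu PgM] by measurable
      show "integrable M (\<lambda>\<omega>. Z \<omega> * D.P g (pos u \<omega>))"
      proof (rule integrable_bounded)
        show "\<bar>Z \<omega> * D.P g (pos u \<omega>)\<bar> \<le> B * C" for \<omega>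
          by (intro abs_mult_le Z(2) bounded_borelD(2)[OF D.bounded_borel_P[OF g]])
      qed (rule measurable_sig_M[OF past_indices zp])
      show "integrable M (I u)"
        using Ib by (intro integrable_bounded[of _ 1]) (auto simp: abs_le_iff intro: order_trans[of _ 0])
      show "indep_var borel (I u) borel (\<lambda>\<omega>. Z \<omega> * D.P g (pos u \<omega>))"
      proof (rule indep_var_sig[of "{Inr (Suc k)}" "past k"])
        show "I u \<in> borel_measurable (sig {Inr (Suc k)})" by (rule IJ)
      qed (use k past_indices zp in \<open>auto simp: past_def\<close>)
    qed
    finally show ?thesis using EI[OF u] by simp
  qed
  \<comment> \<open>Splitting by the parent replaces the random index by constants. The identity is
    only almost sure, since \<open>U (Suc k)\<close> may leave its range on a null set.\<close>
  have "expectation (\<lambda>\<omega>. Z \<omega> * g (pos (Suc k) \<omega>))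
      = expectation (\<lambda>\<omega>. \<Sum>u=1..k. (Z \<omega> * I u \<omega>) * g (pos u \<omega> + \<Delta> (Suc k) \<omega>))"
  proof (rule integral_cong_AE)
    have d [measurable]: "\<Delta> (Suc k) \<in> borel_measurable M" by (rule meas_\<Delta>) simp
    note bounded_borelD(1)[OF g, measurable]
    have [measurable]: "pos (Suc k) \<in> borel_measurable M" by (rule measurable_pos) simp
    show "(\<lambda>\<omega>. Z \<omega> * g (pos (Suc k) \<omega>)) \<in> borel_measurable M" by measurable
    have "(\<lambda>\<omega>. (Z \<omega> * I u \<omega>) * g (pos u \<omega> + \<Delta> (Suc k) \<omega>)) \<in> borel_measurable M" if "u \<in> {1..k}" for u
      using posM[OF that] by measurable
    then show "(\<lambda>\<omega>. \<Sum>u=1..k. (Z \<omega> * I u \<omega>) * g (pos u \<omega> + \<Delta> (Suc k) \<omega>)) \<in> borel_measurable M"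
      by (rule borel_measurable_sum)
    have "AE \<omega> in M. U (Suc k) \<omega> \<in> {1..k}" using AE_U[of "Suc k"] k by simp
    then show "AE \<omega> in M. Z \<omega> * g (pos (Suc k) \<omega>)
        = (\<Sum>u=1..k. (Z \<omega> * I u \<omega>) * g (pos u \<omega> + \<Delta> (Suc k) \<omega>))"
    proof eventually_elim
      case (elim \<omega>)
      have "(\<Sum>u=1..k. (Z \<omega> * I u \<omega>) * g (pos u \<omega> + \<Delta> (Suc k) \<omega>))
          = (\<Sum>u=1..k. if u = U (Suc k) \<omega> then Z \<omega> * g (pos u \<omega> + \<Delta> (Suc k) \<omega>) else 0)"
        by (intro sum.cong) (auto simp: I_def)
      also have "\<dots> = Z \<omega> * g (pos (U (Suc k) \<omega>) \<omega> + \<Delta> (Suc k) \<omega>)"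
        using elim by simp
      also have "\<dots> = Z \<omega> * g (pos (Suc k) \<omega>)"
        using elim k by (subst (2) pos.simps) auto
      finally show ?case by simp
    qed
  qed
  also have "\<dots> = (\<Sum>u=1..k. expectation (\<lambda>\<omega>. (Z \<omega> * I u \<omega>) * g (pos u \<omega> + \<Delta> (Suc k) \<omega>)))"
  proof (rule Bochner_Integration.integral_sum)
    fix u assume u: "u \<in> {1..k}"
    have d [measurable]: "\<Delta> (Suc k) \<in> borel_measurable M" by (rule meas_\<Delta>) simp
    note bounded_borelD(1)[OF g, measurable] posM[OF u, measurable]
    show "integrable M (\<lambda>\<omega>. (Z \<omega> * I u \<omega>) * g (pos u \<omega> + \<Delta> (Suc k) \<omega>))"
    proof (rule integrable_bounded)
      show "\<bar>(Z \<omega> * I u \<omega>) * g (pos u \<omega> + \<Delta> (Suc k) \<omega>)\<bar> \<le> B * C" for \<omega>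
        by (intro abs_mult_le[OF ZI] bounded_borelD(2)[OF g])
    qed measurable
  qed
  also have "\<dots> = (\<Sum>u=1..k. (1 / real k) * expectation (\<lambda>\<omega>. Z \<omega> * D.P g (pos u \<omega>)))"
    using step by simp
  also have "\<dots> = (\<Sum>u=1..k. expectation (\<lambda>\<omega>. (1 / real k) * (Z \<omega> * D.P g (pos u \<omega>))))"
    by simp
  also have "\<dots> = expectation (\<lambda>\<omega>. \<Sum>u=1..k. (1 / real k) * (Z \<omega> * D.P g (pos u \<omega>)))"
  proof (rule Bochner_Integration.integral_sum[symmetric])
    fix u assume u: "u \<in> {1..k}"
    note PgM[measurable] posM[OF u, measurable]
    have "integrable M (\<lambda>\<omega>. Z \<omega> * D.P g (pos u \<omega>))"
    proof (rule integrable_bounded)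
      show "\<bar>Z \<omega> * D.P g (pos u \<omega>)\<bar> \<le> B * C" for \<omega>
        by (intro abs_mult_le Z(2) bounded_borelD(2)[OF D.bounded_borel_P[OF g]])
    qed measurable
    then show "integrable M (\<lambda>\<omega>. (1 / real k) * (Z \<omega> * D.P g (pos u \<omega>)))" by simp
  qed
  also have "\<dots> = expectation (\<lambda>\<omega>. Z \<omega> * avg k (D.P g) \<omega>)"
    by (simp add: avg_def sum_distrib_left sum_divide_distrib)
  finally show ?thesis .
qed

text \<open>The increment in closed form: the newest value minus its conditional mean, divided by
  the new size. It gives both the martingale property and the size of the increments.\<close>

lemma avg_Suc_diff:
  assumes k: "k \<ge> 1"
  shows "avg (Suc k) g \<omega> - avg k (D.Q k g) \<omega> = (g (pos (Suc k) \<omega>) - avg k (D.P g) \<omega>) / real (Suc k)"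
proof -
  have "avg k (D.Q k g) \<omega>
      = (\<Sum>i=1..k. real k * g (pos i \<omega>) + D.P g (pos i \<omega>)) / real (Suc k) / real k"
    unfolding avg_def D.Q_def by (simp only: sum_divide_distrib)
  also have "\<dots> = (real k * (\<Sum>i=1..k. g (pos i \<omega>)) + (\<Sum>i=1..k. D.P g (pos i \<omega>))) / real k / real (Suc k)"
    by (simp add: sum.distrib sum_distrib_left mult.commute del: of_nat_Suc)
  also have "\<dots> = ((\<Sum>i=1..k. g (pos i \<omega>)) + avg k (D.P g) \<omega>) / real (Suc k)"
    using k by (simp add: avg_def add_divide_distrib del: of_nat_Suc)
  finally show ?thesis
    by (simp add: avg_def add_divide_distrib diff_divide_distrib del: of_nat_Suc)
qed

lemma expectation_avg_Suc:
  assumes k: "k \<ge> 1" and Z: "Z \<in> borel_measurable (sig (past k))" "\<And>\<omega>. \<bar>Z \<omega>\<bar> \<le> B"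
    and g: "bounded_borel C g"
  shows "expectation (\<lambda>\<omega>. Z \<omega> * (avg (Suc k) g \<omega> - avg k (D.Q k g) \<omega>)) = 0"
proof -
  note [measurable] = measurable_sig_M[OF past_indices Z(1)] avg_measurable[OF D.bounded_borel_P[OF g]]
    bounded_borelD(1)[OF g]
  have [measurable]: "pos (Suc k) \<in> borel_measurable M" by (rule measurable_pos) simp
  have int: "integrable M (\<lambda>\<omega>. Z \<omega> * g (pos (Suc k) \<omega>))" "integrable M (\<lambda>\<omega>. Z \<omega> * avg k (D.P g) \<omega>)"
    by (rule integrable_bounded[of _ "B * C"], measurable,
        intro abs_mult_le Z(2) bounded_borelD(2)[OF g] avg_bound[OF D.bounded_borel_P[OF g]])+
  have "expectation (\<lambda>\<omega>. Z \<omega> * (avg (Suc k) g \<omega> - avg k (D.Q k g) \<omega>))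
      = expectation (\<lambda>\<omega>. (Z \<omega> * g (pos (Suc k) \<omega>) - Z \<omega> * avg k (D.P g) \<omega>) / real (Suc k))"
    unfolding avg_Suc_diff[OF k] by (simp add: right_diff_distrib)
  also have "\<dots> = 0"
    using int expectation_new_node[OF k Z g] by simp
  finally show ?thesis .
qed

text \<open>The averages \<open>avg k (H k (n - k) g)\<close>, \<open>k = m, \<dots>, n\<close>, form a martingale with increments bounded
  by \<open>2 C / (k + 1)\<close>.\<close>

lemma avg_martingale:
  assumes m: "m \<ge> 1" and g: "bounded_borel C g"
    and Z: "Z \<in> borel_measurable (sig (past m))" "\<And>\<omega>. \<bar>Z \<omega>\<bar> \<le> B"
  shows "expectation (\<lambda>\<omega>. Z \<omega> * (avg (m + l) g \<omega> - avg m (D.H m l g) \<omega>)) = 0"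
  using m Z
proof (induction l arbitrary: m)
  case 0
  then show ?case by simp
next
  case (Suc l)
  let ?h = "D.H (Suc m) l g"
  have h: "bounded_borel C ?h" by (rule D.bounded_borel_H[OF g])
  note [measurable] = measurable_sig_M[OF past_indices Suc.prems(2)]
    avg_measurable[OF g] avg_measurable[OF h] avg_measurable[OF D.bounded_borel_Q[OF h]]
  have b: "\<bar>Z \<omega> * (x - y)\<bar> \<le> B * (2 * C)" if "\<bar>x\<bar> \<le> C" "\<bar>y\<bar> \<le> C" for \<omega> x y
    using that by (intro abs_mult_le Suc.prems(3)) auto
  have int: "integrable M (\<lambda>\<omega>. Z \<omega> * (avg (Suc m + l) g \<omega> - avg (Suc m) ?h \<omega>))"
    "integrable M (\<lambda>\<omega>. Z \<omega> * (avg (Suc m) ?h \<omega> - avg m (D.Q m ?h) \<omega>))"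
    by (rule integrable_bounded[of _ "B * (2 * C)"],
        measurable, intro b avg_bound[OF g] avg_bound[OF h] avg_bound[OF D.bounded_borel_Q[OF h]])+
  have "expectation (\<lambda>\<omega>. Z \<omega> * (avg (m + Suc l) g \<omega> - avg m (D.H m (Suc l) g) \<omega>))
      = expectation (\<lambda>\<omega>. Z \<omega> * (avg (Suc m + l) g \<omega> - avg (Suc m) ?h \<omega>)
          + Z \<omega> * (avg (Suc m) ?h \<omega> - avg m (D.Q m ?h) \<omega>))"
    by (simp add: algebra_simps)
  also have "\<dots> = expectation (\<lambda>\<omega>. Z \<omega> * (avg (Suc m + l) g \<omega> - avg (Suc m) ?h \<omega>))
          + expectation (\<lambda>\<omega>. Z \<omega> * (avg (Suc m) ?h \<omega> - avg m (D.Q m ?h) \<omega>))"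
    using int by (rule Bochner_Integration.integral_add)
  also have "\<dots> = 0"
    using expectation_avg_Suc[OF Suc.prems h] Suc.IH[of "Suc m"]
      measurable_sig_mono[OF past_mono Suc.prems(2)] Suc.prems(3) by simp
  finally show ?case .
qed

text \<open>Martingale increments are orthogonal, so their second moments add up. Bounding
  \<open>1 / (k + 1)^2\<close> by \<open>1 / k - 1 / (k + 1)\<close> makes the sum telescope along
  the induction.\<close>

lemma avg_variance:
  assumes m: "m \<ge> 1" and g: "bounded_borel C g"
  shows "expectation (\<lambda>\<omega>. (avg (m + l) g \<omega> - avg m (D.H m l g) \<omega>)\<^sup>2)
           \<le> 4 * C\<^sup>2 * (1 / real m - 1 / real (m + l))"
  using m
proof (induction l arbitrary: m)
  case 0
  then show ?case by simp
next
  case (Suc l)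
  let ?h = "D.H (Suc m) l g"
  have h: "bounded_borel C ?h" by (rule D.bounded_borel_H[OF g])
  have C: "C \<ge> 0" using bounded_borelD(2)[OF g, of 0] by linarith
  define a where "a \<omega> = avg (Suc m + l) g \<omega> - avg (Suc m) ?h \<omega>" for \<omega>
  define b where "b \<omega> = avg (Suc m) ?h \<omega> - avg m (D.Q m ?h) \<omega>" for \<omega>
  note [measurable] = avg_measurable[OF g] avg_measurable[OF h] avg_measurable[OF D.bounded_borel_Q[OF h]]
  have [measurable]: "a \<in> borel_measurable M" "b \<in> borel_measurable M"
    unfolding a_def[abs_def] b_def[abs_def] by measurable
  have ab: "\<bar>a \<omega>\<bar> \<le> 2 * C" "\<bar>b \<omega>\<bar> \<le> 2 * C" for \<omega>
    using avg_bound[OF g, of "Suc m + l" \<omega>] avg_bound[OF h, of "Suc m" \<omega>]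
      avg_bound[OF D.bounded_borel_Q[OF h], of m m \<omega>] unfolding a_def b_def by linarith+
  have int: "integrable M (\<lambda>\<omega>. (a \<omega>)\<^sup>2)" "integrable M (\<lambda>\<omega>. (b \<omega>)\<^sup>2)" "integrable M (\<lambda>\<omega>. b \<omega> * a \<omega>)"
    unfolding power2_eq_square
    by (rule integrable_bounded[of _ "(2 * C) * (2 * C)"], measurable, intro abs_mult_le ab)+
  have "b \<in> borel_measurable (sig (past (Suc m)))"
    unfolding b_def[abs_def]
    using avg_past[OF h order_refl] avg_past[OF D.bounded_borel_Q[OF h, of m], of m "Suc m"] by measurable
  \<comment> \<open>The first increment \<open>b\<close> is known at time \<open>Suc m\<close>, so
    it is an admissible multiplier for the later difference \<open>a\<close>.\<close>
  from avg_martingale[OF _ g this ab(2), of l]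
  have cross: "expectation (\<lambda>\<omega>. b \<omega> * a \<omega>) = 0" by (simp add: a_def)
  have b2: "(b \<omega>)\<^sup>2 \<le> 4 * C\<^sup>2 * (1 / real m - 1 / real (Suc m))" for \<omega>
  proof -
    have "\<bar>b \<omega>\<bar> \<le> 2 * C / real (Suc m)"
      unfolding b_def avg_Suc_diff[OF Suc.prems] abs_divide
      using bounded_borelD(2)[OF h, of "pos (Suc m) \<omega>"] avg_bound[OF D.bounded_borel_P[OF h], of m \<omega>]
      by (intro divide_mono) auto
    then have "\<bar>b \<omega>\<bar>\<^sup>2 \<le> (2 * C / real (Suc m))\<^sup>2" by (intro power_mono) auto
    also have "\<dots> = 4 * C\<^sup>2 * (1 / (real (Suc m))\<^sup>2)" by (simp add: power_divide power_mult_distrib)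
    also have "\<dots> \<le> 4 * C\<^sup>2 * (1 / real m - 1 / real (Suc m))"
    proof (rule mult_left_mono)
      have "1 / real m - 1 / real (Suc m) = 1 / (real m * real (Suc m))"
        using Suc.prems by (simp add: field_simps)
      also have "\<dots> \<ge> 1 / (real (Suc m))\<^sup>2"
        using Suc.prems by (intro divide_left_mono) (auto simp: power2_eq_square)
      finally show "1 / (real (Suc m))\<^sup>2 \<le> 1 / real m - 1 / real (Suc m)" .
    qed auto
    finally show ?thesis by simp
  qed
  have "expectation (\<lambda>\<omega>. (avg (m + Suc l) g \<omega> - avg m (D.H m (Suc l) g) \<omega>)\<^sup>2)
      = expectation (\<lambda>\<omega>. (a \<omega>)\<^sup>2 + (b \<omega>)\<^sup>2 + 2 * (b \<omega> * a \<omega>))"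
    by (simp add: a_def b_def power2_eq_square algebra_simps)
  also have "\<dots> = expectation (\<lambda>\<omega>. (a \<omega>)\<^sup>2) + expectation (\<lambda>\<omega>. (b \<omega>)\<^sup>2)"
    using int cross by simp
  also have "\<dots> \<le> 4 * C\<^sup>2 * (1 / real (Suc m) - 1 / real (Suc m + l)) + 4 * C\<^sup>2 * (1 / real m - 1 / real (Suc m))"
  proof (rule add_mono)
    show "expectation (\<lambda>\<omega>. (a \<omega>)\<^sup>2) \<le> 4 * C\<^sup>2 * (1 / real (Suc m) - 1 / real (Suc m + l))"
      using Suc.IH[of "Suc m"] by (simp add: a_def)
    have "expectation (\<lambda>\<omega>. (b \<omega>)\<^sup>2) \<le> expectation (\<lambda>\<omega>. 4 * C\<^sup>2 * (1 / real m - 1 / real (Suc m)))"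
      using int b2 by (intro integral_mono) auto
    then show "expectation (\<lambda>\<omega>. (b \<omega>)\<^sup>2) \<le> 4 * C\<^sup>2 * (1 / real m - 1 / real (Suc m))"
      by (simp add: prob_space)
  qed
  also have "\<dots> = 4 * C\<^sup>2 * (1 / real m - 1 / real (m + Suc l))"
    by (simp add: algebra_simps)
  finally show ?case .
qed

text \<open>A position is a sum of steps, and for a uniform node among \<open>m\<close> their mean
  number is \<open>harm m\<close>, the root contributing one. By subadditivity each costs at most
  the mean of \<open>g\<close> at a single step.\<close>

lemma expectation_avg_subadditive:
  assumes g: "bounded_borel C g" and sub: "\<And>x y. g (x + y) \<le> g x + g y" and m: "m \<ge> 1"
  shows "expectation (avg m g) \<le> harm m * D.P g 0"
  using m
proof (induction m rule: nat_induct_at_least)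
  case base
  have "expectation (avg 1 g) = expectation (\<lambda>\<omega>. g (\<Delta> 1 \<omega>))"
    unfolding avg_def[abs_def] by (simp add: pos_1[simplified])
  also have "\<dots> = D.P g 0"
    using bounded_borelD(1)[OF g] meas_\<Delta>[of 1]
    unfolding D.P_def unfolding law_def by (subst integral_distr) auto
  finally show ?case by (simp add: harm_def)
next
  case (Suc m)
  let ?G = "D.P g 0"
  have PgG: "D.P g x \<le> g x + ?G" for x
  proof -
    have "D.P g x \<le> (\<integral>y. g x + g (0 + y) \<partial>law)"
      unfolding D.P_def
    proof (rule integral_mono[OF D.integrable_shift[OF g]])
      show "integrable law (\<lambda>y. g x + g (0 + y))"
        using D.integrable_shift[OF g, of 0] by simp
    qed (use sub in simp)
    also have "\<dots> = g x + ?G"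
      using D.integrable_shift[OF g, of 0] by (simp add: D.P_def D.prob_space)
    finally show ?thesis .
  qed
  have Qle: "D.Q m g x \<le> g x + ?G / real (Suc m)" for x
  proof -
    have "D.Q m g x \<le> (real (Suc m) * g x + ?G) / real (Suc m)"
      using PgG[of x] unfolding D.Q_def by (intro divide_right_mono) (auto simp: algebra_simps)
    then show ?thesis by (simp add: add_divide_distrib del: of_nat_Suc)
  qed
  have avg_le: "avg m (D.Q m g) \<omega> \<le> avg m g \<omega> + ?G / real (Suc m)" for \<omega>
  proof -
    have "(\<Sum>i=1..m. D.Q m g (pos i \<omega>)) \<le> (\<Sum>i=1..m. g (pos i \<omega>) + ?G / real (Suc m))"
      using Qle by (intro sum_mono) auto
    also have "\<dots> = (\<Sum>i=1..m. g (pos i \<omega>)) + real m * (?G / real (Suc m))"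
      by (simp add: sum.distrib)
    finally have "avg m (D.Q m g) \<omega> \<le> ((\<Sum>i=1..m. g (pos i \<omega>)) + real m * (?G / real (Suc m))) / real m"
      unfolding avg_def by (rule divide_right_mono) simp
    then show ?thesis using Suc.hyps by (simp add: avg_def add_divide_distrib)
  qed
  have int: "integrable M (avg k g)" "integrable M (avg k (D.Q m g))" for k
    using avg_measurable[OF g] avg_bound[OF g] avg_measurable[OF D.bounded_borel_Q[OF g]]
      avg_bound[OF D.bounded_borel_Q[OF g]] by (auto intro!: integrable_bounded[of _ C])
  have "expectation (\<lambda>\<omega>. 1 * (avg (Suc m) g \<omega> - avg m (D.Q m g) \<omega>)) = 0"
    by (rule expectation_avg_Suc[OF Suc.hyps _ _ g, where B = 1]) auto
  then have "expectation (avg (Suc m) g) = expectation (avg m (D.Q m g))"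
    using int by simp
  also have "\<dots> \<le> expectation (\<lambda>\<omega>. avg m g \<omega> + ?G / real (Suc m))"
    using int avg_le by (intro integral_mono) auto
  also have "\<dots> = expectation (avg m g) + ?G / real (Suc m)"
    using int by (simp add: prob_space)
  also have "\<dots> \<le> harm m * ?G + ?G / real (Suc m)"
    using Suc.IH by simp
  also have "\<dots> = harm (Suc m) * ?G"
    by (simp add: harm_Suc field_simps)
  finally show ?case .
qed

section \<open>The walk with independent steps\<close>

definition walk :: "nat \<Rightarrow> 's \<Rightarrow> 'd" where
  "walk k \<omega> = (\<Sum>i\<in>{1..k}. \<Delta> i \<omega>)"

lemma measurable_walk [measurable]: "walk k \<in> borel_measurable M"
  unfolding walk_def[abs_def] by (intro borel_measurable_sum meas_\<Delta>) auto

lemma expectation_walk: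
  assumes g: "bounded_borel C g"
  shows "expectation (\<lambda>\<omega>. g (walk k \<omega>)) = (D.P ^^ k) g 0"
  using g
proof (induction k arbitrary: g)
  case 0
  then show ?case by (simp add: walk_def prob_space)
next
  case (Suc k)
  have V: "walk k \<in> borel_measurable (sig (Inl ` {1..k}))"
    unfolding walk_def[abs_def] by (intro borel_measurable_sum measurable_sig_\<Delta>) auto
  have "expectation (\<lambda>\<omega>. 1 * g (walk k \<omega> + \<Delta> (Suc k) \<omega>)) = expectation (\<lambda>\<omega>. 1 * D.P g (walk k \<omega>))"
    by (rule integral_new_step[OF _ _ _ _ _ V Suc.prems, where B = 1]) auto
  moreover have "walk (Suc k) \<omega> = walk k \<omega> + \<Delta> (Suc k) \<omega>" for \<omega>
    by (simp add: walk_def)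
  ultimately show ?case
    using Suc.IH[OF D.bounded_borel_P[OF Suc.prems]] by (simp add: funpow_swap1)
qed

end

section \<open>Scaling limit of the walk and tail of its steps\<close>

lemma (in prob_space) norm_tight:
  fixes X :: "'a \<Rightarrow> 'b::euclidean_space"
  assumes X: "X \<in> borel_measurable M" and "\<delta> < 1"
  shows "\<exists>r>0. prob {\<omega>\<in>space M. norm (X \<omega>) \<le> r} \<ge> \<delta>"
proof -
  note X[measurable]
  have "(\<lambda>n::nat. prob {\<omega>\<in>space M. norm (X \<omega>) \<le> real n}) \<longlonglongrightarrow> prob (\<Union>n::nat. {\<omega>\<in>space M. norm (X \<omega>) \<le> real n})"
    by (rule finite_Lim_measure_incseq) (auto simp: incseq_def)
  also have "(\<Union>n::nat. {\<omega>\<in>space M. norm (X \<omega>) \<le> real n}) = space M"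
    using real_arch_simple by auto
  finally have "(\<lambda>n::nat. prob {\<omega>\<in>space M. norm (X \<omega>) \<le> real n}) \<longlonglongrightarrow> 1"
    by (simp add: prob_space)
  from order_tendstoD(1)[OF this \<open>\<delta> < 1\<close>] eventually_gt_at_top[of "0::nat"]
  have "\<forall>\<^sub>F n in sequentially. n > 0 \<and> \<delta> < prob {\<omega>\<in>space M. norm (X \<omega>) \<le> real n}"
    by eventually_elim auto
  then obtain n :: nat where "n > 0" "\<delta> < prob {\<omega>\<in>space M. norm (X \<omega>) \<le> real n}"
    by (auto simp: eventually_sequentially)
  then show ?thesis by (intro exI[of _ "real n"]) auto
qed

text \<open>The sum of the variables has finite mean, hence is finite almost surely, and the terms
  of a convergent series tend to 0.\<close>

lemma (in prob_space) AE_tendsto_0_if_summable_expectation: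
  fixes Z :: "nat \<Rightarrow> 'a \<Rightarrow> real"
  assumes Z: "\<And>j. integrable M (Z j)" "\<And>j \<omega>. 0 \<le> Z j \<omega>"
    and s: "summable (\<lambda>j. expectation (Z j))"
  shows "AE \<omega> in M. (\<lambda>j. Z j \<omega>) \<longlonglongrightarrow> 0"
proof -
  have [measurable]: "Z j \<in> borel_measurable M" for j using Z(1) by auto
  have "(\<integral>\<^sup>+\<omega>. (\<Sum>j. ennreal (Z j \<omega>)) \<partial>M) = (\<Sum>j. \<integral>\<^sup>+\<omega>. ennreal (Z j \<omega>) \<partial>M)"
    by (rule nn_integral_suminf) measurable
  also have "\<dots> = (\<Sum>j. ennreal (expectation (Z j)))"
    using Z by (simp add: nn_integral_eq_integral)
  also have "\<dots> = ennreal (\<Sum>j. expectation (Z j))"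
    using s Z by (intro suminf_ennreal2) auto
  finally have "(\<integral>\<^sup>+\<omega>. (\<Sum>j. ennreal (Z j \<omega>)) \<partial>M) \<noteq> \<infinity>" by simp
  then have "AE \<omega> in M. (\<Sum>j. ennreal (Z j \<omega>)) \<noteq> \<infinity>"
    by (intro nn_integral_noteq_infinite) auto
  then show ?thesis
  proof eventually_elim
    case (elim \<omega>)
    then have "summable (\<lambda>j. Z j \<omega>)"
      using Z(2) by (intro summable_suminf_not_top) auto
    then show ?case by (rule summable_LIMSEQ_zero)
  qed
qed

text \<open>The sum is the mean depth of a uniform node of the tree of size \<open>m + l\<close>
  below its ancestor among the first \<open>m\<close>. A loss of 1 is harmless, because the
  difference from \<open>ln (m + l)\<close> will be divided by \<open>ln (m + l)\<close>.\<close>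

lemma sum_inverse_Suc_bounds:
  assumes "m \<ge> 1"
  shows "(\<Sum>k=m..<m+l. 1 / real (Suc k)) \<le> ln (real (m + l)) - ln (real m)"
    and "ln (real (m + l)) - ln (real m) - 1 \<le> (\<Sum>k=m..<m+l. 1 / real (Suc k))"
proof -
  have up: "1 / real (Suc k) \<le> ln (real (Suc k)) - ln (real k)" if "k \<ge> 1" for k
  proof -
    have "ln (real k / real (Suc k)) \<le> real k / real (Suc k) - 1"
      using that by (intro ln_le_minus_one) auto
    then show ?thesis using that by (simp add: ln_div field_simps)
  qed
  have lo: "ln (real (Suc (Suc k))) - ln (real (Suc k)) \<le> 1 / real (Suc k)" for k
  proof -
    have "ln (real (Suc (Suc k)) / real (Suc k)) \<le> real (Suc (Suc k)) / real (Suc k) - 1"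
      by (intro ln_le_minus_one) auto
    then show ?thesis by (simp add: ln_div field_simps)
  qed
  show "(\<Sum>k=m..<m+l. 1 / real (Suc k)) \<le> ln (real (m + l)) - ln (real m)"
  proof (induction l)
    case (Suc l)
    show ?case using Suc up[of "m + l"] assms by simp
  qed simp
  have "ln (real (Suc (m + l))) - ln (real (Suc m)) \<le> (\<Sum>k=m..<m+l. 1 / real (Suc k))"
  proof (induction l)
    case (Suc l)
    show ?case using Suc lo[of "m + l"] by simp
  qed simp
  moreover have "ln (real (m + l)) \<le> ln (real (Suc (m + l)))" using assms by simp
  moreover have "ln (real (Suc m)) \<le> ln (real m) + 1"
  proof -
    have "1 / real m \<le> 1" using assms by simp
    moreover have "ln (real (Suc m)) - ln (real m) \<le> 1 / real m" using lo[of "m - 1"] assms by simp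
    ultimately show ?thesis by linarith
  qed
  ultimately show "ln (real (m + l)) - ln (real m) - 1 \<le> (\<Sum>k=m..<m+l. 1 / real (Suc k))"
    by linarith
qed

lemma harm_le_ln:
  assumes "m \<ge> 1"
  shows "harm m \<le> 1 + ln (real m)"
proof -
  have "harm (1 + l) = 1 + (\<Sum>k=1..<1+l. 1 / real (Suc k))" for l
  proof (induction l)
    case (Suc l)
    then show ?case by (simp add: harm_Suc inverse_eq_divide)
  qed (simp add: harm_def)
  from this[of "m - 1"] sum_inverse_Suc_bounds(1)[of 1 "m - 1"] assms show ?thesis by simp
qed

section \<open>Lipschitz test functions of bounded support\<close>

definition test_function :: "real \<Rightarrow> real \<Rightarrow> ('a::euclidean_space \<Rightarrow> real) \<Rightarrow> bool" where
  "test_function K R f \<longleftrightarrow> 0 \<le> K \<and> 0 \<le> R \<and> (\<forall>x y. \<bar>f x - f y\<bar> \<le> K * dist x y)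
     \<and> (\<forall>x. R \<le> norm x \<longrightarrow> f x = 0) \<and> (\<forall>x. \<bar>f x\<bar> \<le> K)"

text \<open>Within radius \<open>2 * R\<close> a dilation moves points by at most
  \<open>2 * R * \<bar>s - 1\<bar>\<close>. Beyond it, both points are outside the support, since
  \<open>s\<close> is at least one half.\<close>

lemma test_function_dilation:
  assumes f: "test_function K R f" and s: "1 / 2 \<le> s"
  shows "\<bar>f (s *\<^sub>R x) - f x\<bar> \<le> 2 * R * K * \<bar>s - 1\<bar>"
proof (cases "norm x \<le> 2 * R")
  case True
  have "\<bar>f (s *\<^sub>R x) - f x\<bar> \<le> K * dist (s *\<^sub>R x) x" using f by (auto simp: test_function_def)
  also have "dist (s *\<^sub>R x) x = \<bar>s - 1\<bar> * norm x"
    by (metis dist_norm norm_scaleR scaleR_left_diff_distrib scaleR_one)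
  also have "K * (\<bar>s - 1\<bar> * norm x) \<le> K * (\<bar>s - 1\<bar> * (2 * R))"
    using True f by (intro mult_left_mono) (auto simp: test_function_def)
  finally show ?thesis by (simp add: mult_ac)
next
  case False
  have "R \<le> (1 / 2) * norm x" using False by simp
  also have "\<dots> \<le> s * norm x" using s by (rule mult_right_mono) simp
  also have "\<dots> = norm (s *\<^sub>R x)" using s by simp
  finally have "f (s *\<^sub>R x) = 0" "f x = 0" using f False by (auto simp: test_function_def)
  then show ?thesis using f by (simp add: test_function_def)
qed

text \<open>The Lipschitz bound serves small shifts and the sup bound large ones. The cutoff at 1
  allows steps without a finite mean.\<close>

lemma test_function_shift:
  assumes f: "test_function K R f"
  shows "\<bar>f (x + z) - f z\<bar> \<le> 2 * K * min 1 (norm x)"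
proof -
  have "\<bar>f (x + z) - f z\<bar> \<le> K * norm x" "\<bar>f (x + z)\<bar> \<le> K" "\<bar>f z\<bar> \<le> K" "0 \<le> K * norm x"
    using f unfolding test_function_def by (metis add_diff_cancel_right' dist_norm, auto)
  then show ?thesis by (auto simp: min_def)
qed

lemma test_function_bounded_borel:
  assumes f: "test_function K R f"
  shows "bounded_borel K (\<lambda>x. f (x /\<^sub>R a))"
proof -
  have "K-lipschitz_on UNIV f"
    using f by (intro lipschitz_onI) (auto simp: test_function_def dist_real_def)
  then have [measurable]: "f \<in> borel_measurable borel"
    by (intro borel_measurable_continuous_onI lipschitz_on_continuous_on)
  show ?thesis using f by (auto simp: bounded_borel_def test_function_def)
qed

section \<open>Consequences of the convergence in law of the scaled walk\<close>

locale scaled_random_recursive_walk = random_recursive_walk M \<Delta> U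
  for M :: "'s measure" and \<Delta> :: "nat \<Rightarrow> 's \<Rightarrow> 'd::euclidean_space" and U +
  fixes \<alpha> :: real and \<nu> :: "'d measure"
  assumes \<alpha>: "\<alpha> > 0" and \<nu>: "prob_space \<nu>" "sets \<nu> = sets borel"
    and conv: "weak_conv_fm
        (\<lambda>n. distr M borel (\<lambda>\<omega>. (real n powr (-\<alpha>)) *\<^sub>R (\<Sum>i\<in>{1..n}. \<Delta> i \<omega>))) \<nu>"
begin

lemma P_pow_indicator:
  assumes [measurable]: "A \<in> sets borel"
  shows "(D.P ^^ k) (indicat_real A) 0 = prob {\<omega>\<in>space M. walk k \<omega> \<in> A}"
proof -
  have "bounded_borel 1 (indicat_real A)" by (auto simp: bounded_borel_def indicator_def)
  then have "(D.P ^^ k) (indicat_real A) 0 = expectation (\<lambda>\<omega>. indicat_real A (walk k \<omega>))"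
    using expectation_walk by simp
  also have "\<dots> = expectation (indicat_real {\<omega>\<in>space M. walk k \<omega> \<in> A})"
    by (intro Bochner_Integration.integral_cong) (auto simp: indicator_def)
  also have "\<dots> = prob ({\<omega>\<in>space M. walk k \<omega> \<in> A} \<inter> space M)"
    by simp
  also have "{\<omega>\<in>space M. walk k \<omega> \<in> A} \<inter> space M = {\<omega>\<in>space M. walk k \<omega> \<in> A}" by auto
  finally show ?thesis .
qed

lemma P_pow_conv:
  assumes f: "continuous_on UNIV f" "\<And>x. \<bar>f x\<bar> \<le> B"
  shows "(\<lambda>k. (D.P ^^ k) (\<lambda>x. f (x /\<^sub>R (real k powr \<alpha>))) 0) \<longlonglongrightarrow> integral\<^sup>L \<nu> f"
proof -
  have [measurable]: "f \<in> borel_measurable borel" by (rule borel_measurable_continuous_onI[OF f(1)])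
  have "(D.P ^^ k) (\<lambda>x. f (x /\<^sub>R (real k powr \<alpha>))) 0
      = integral\<^sup>L (distr M borel (\<lambda>\<omega>. (real k powr (-\<alpha>)) *\<^sub>R (\<Sum>i\<in>{1..k}. \<Delta> i \<omega>))) f" for k
  proof -
    have "bounded_borel B (\<lambda>x. f (x /\<^sub>R (real k powr \<alpha>)))"
      unfolding bounded_borel_def using f(2) by (auto intro!: measurable_compose[of _ _ borel f])
    from expectation_walk[OF this, of k, symmetric] show ?thesis
      unfolding walk_def[symmetric] by (simp add: integral_distr powr_minus)
  qed
  moreover have "bounded (range f)" using f(2) by (auto simp: bounded_iff)
  ultimately show ?thesis using conv f(1) by (simp add: weak_conv_fm_def)
qed

text \<open>Convergence in law gives tightness for all large \<open>k\<close>; each of the finitely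
  many remaining walks is tight by itself.\<close>

lemma walk_tight:
  "\<exists>R>0. \<forall>k c. R * real k powr \<alpha> \<le> c \<longrightarrow> (D.P ^^ k) (indicat_real {x. norm x \<le> c}) 0 \<ge> 9 / 10"
proof -
  interpret \<nu>: prob_space \<nu> by (rule \<nu>(1))
  note \<nu>(2)[measurable_cong]
  have id: "(\<lambda>x. x) \<in> borel_measurable \<nu>" by measurable
  have sp: "space \<nu> = UNIV" using sets_eq_imp_space_eq[OF \<nu>(2)] by simp
  obtain R0 where R0: "R0 > 0" "19 / 20 \<le> measure \<nu> {x. norm x \<le> R0}"
    using \<nu>.norm_tight[OF id, of "19/20"] by (auto simp: sp)
  \<comment> \<open>A continuous function between the indicators of the balls of radius
    \<open>R0\<close> and \<open>R0 + 1\<close>. The level 19/20 leaves room for the passage to the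
    limit down to 9/10.\<close>
  define h :: "'d \<Rightarrow> real" where "h x = max 0 (min 1 (R0 + 1 - norm x))" for x
  have hc: "continuous_on UNIV h" unfolding h_def by (intro continuous_intros)
  have hb: "\<bar>h x\<bar> \<le> 1" for x by (auto simp: h_def)
  have "19 / 20 \<le> (\<integral>x. indicat_real {x. norm x \<le> R0} x \<partial>\<nu>)"
    using R0(2) by (simp add: sp)
  also have "\<dots> \<le> integral\<^sup>L \<nu> h"
  proof (rule integral_mono)
    show "integrable \<nu> (\<lambda>x. indicat_real {x. norm x \<le> R0} x)"
      by (intro integrable_real_indicator) (auto simp: \<nu>.emeasure_eq_measure)
    show "integrable \<nu> h" by (rule integrable_bounded_continuous[OF \<nu> hc hb])
  qed (auto simp: h_def indicator_def)
  finally have "9 / 10 < integral\<^sup>L \<nu> h" by simp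
  from order_tendstoD(1)[OF P_pow_conv[OF hc hb] this] obtain k0 where
    k0: "\<And>k. k \<ge> k0 \<Longrightarrow> 9 / 10 < (D.P ^^ k) (\<lambda>x. h (x /\<^sub>R (real k powr \<alpha>))) 0"
    by (auto simp: eventually_sequentially)
  have ind_mono: "(D.P ^^ k) g 0 \<le> (D.P ^^ k) g' 0"
    if "bounded_borel 1 g" "bounded_borel 1 g'" "\<And>x. g x \<le> g' x" for g g' k
  proof -
    have "expectation (\<lambda>\<omega>. g (walk k \<omega>)) \<le> expectation (\<lambda>\<omega>. g' (walk k \<omega>))"
      using that bounded_borelD[OF that(1)] bounded_borelD[OF that(2)]
      by (intro integral_mono integrable_bounded[of _ 1] measurable_compose[OF measurable_walk]) auto
    then show ?thesis using expectation_walk that(1,2) by simp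
  qed
  have bb: "bounded_borel 1 (indicat_real {x. norm x \<le> c})" for c
    by (auto simp: bounded_borel_def indicator_def)
  have "\<exists>r>0. prob {\<omega>\<in>space M. norm (walk k \<omega>) \<le> r} \<ge> 9 / 10" for k
    by (rule norm_tight) auto
  then obtain r where r: "\<And>k. r k > 0" "\<And>k. prob {\<omega>\<in>space M. norm (walk k \<omega>) \<le> r k} \<ge> 9 / 10"
    by metis
  \<comment> \<open>The sum dominates each of its nonnegative terms, so \<open>R\<close> exceeds all
    the radii for small \<open>k\<close> at once.\<close>
  define R where "R = R0 + 1 + (\<Sum>k<max k0 1. r k)"
  have "0 \<le> (\<Sum>k<max k0 1. r k)" using r(1) by (intro sum_nonneg) (simp add: less_imp_le)
  then have "R \<ge> R0 + 1" unfolding R_def by linarith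
  moreover have "r k \<le> R" if "k < max k0 1" for k
    using that r(1) R0(1) member_le_sum[of k "{..<max k0 1}" r] unfolding R_def
    by (auto simp: less_imp_le)
  moreover have "(D.P ^^ k) (indicat_real {x. norm x \<le> c}) 0 \<ge> 9 / 10"
    if "R * real k powr \<alpha> \<le> c" and R: "R \<ge> R0 + 1" "\<And>k. k < max k0 1 \<Longrightarrow> r k \<le> R" for k c
  proof (cases "k = 0")
    case True
    then show ?thesis using that(1) \<alpha> by simp
  next
    case k: False
    have pos: "real k powr \<alpha> \<ge> 1" using k \<alpha> by (intro ge_one_powr_ge_zero) auto
    show ?thesis
    proof (cases "k < k0")
      case True
      have "r k \<le> R * 1" using R(2)[of k] True by simp
      also have "\<dots> \<le> R * real k powr \<alpha>" using pos R(1) R0(1) by (intro mult_left_mono) auto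
      finally have "r k \<le> c" using that(1) by simp
      then have "prob {\<omega>\<in>space M. norm (walk k \<omega>) \<le> r k} \<le> prob {\<omega>\<in>space M. norm (walk k \<omega>) \<le> c}"
        by (intro finite_measure_mono) auto
      then show ?thesis using r(2)[of k] by (simp add: P_pow_indicator)
    next
      case False
      have [measurable]: "h \<in> borel_measurable borel" by (rule borel_measurable_continuous_onI[OF hc])
      have "(D.P ^^ k) (\<lambda>x. h (x /\<^sub>R (real k powr \<alpha>))) 0 \<le> (D.P ^^ k) (indicat_real {x. norm x \<le> c}) 0"
      proof (rule ind_mono[OF _ bb])
        show "bounded_borel 1 (\<lambda>x. h (x /\<^sub>R (real k powr \<alpha>)))" using hb by (auto simp: bounded_borel_def)
        show "h (x /\<^sub>R (real k powr \<alpha>)) \<le> indicat_real {x. norm x \<le> c} x" for x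
        proof (cases "norm x \<le> c")
          case False
          then have "(R0 + 1) * real k powr \<alpha> \<le> norm x"
            using that(1) mult_right_mono[OF R(1), of "real k powr \<alpha>"] by simp
          then have "R0 + 1 \<le> norm x / real k powr \<alpha>" using pos k by (subst pos_le_divide_eq) auto
          then have "R0 + 1 \<le> norm (x /\<^sub>R (real k powr \<alpha>))" by (simp add: divide_inverse mult.commute)
          then show ?thesis by (simp add: h_def)
        qed (auto simp: h_def)
      qed
      with k0[of k] False show ?thesis by simp
    qed
  qed
  ultimately show ?thesis using R0(1) by (intro exI[of _ R]) auto
qed

text \<open>A walk of \<open>k\<close> steps stays of order \<open>k powr \<alpha>\<close> with
  probability at least 9/10, so a step of larger order among the \<open>k\<close> is unlikely. Hence
  such a step has probability \<open>O(1/k)\<close>, which is a power of its length.\<close>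

lemma step_tail:
  "\<exists>K>0. \<forall>x>0. measure law {y. x < norm y} \<le> K * x powr (- (1 / \<alpha>))"
proof -
  from walk_tight obtain R where R: "R > 0"
    "\<And>k c. R * real k powr \<alpha> \<le> c \<Longrightarrow> (D.P ^^ k) (indicat_real {x. norm x \<le> c}) 0 \<ge> 9 / 10"
    by blast
  have tail: "real k * measure law {y. 4 * (R * real k powr \<alpha>) < norm y} \<le> 1 / 8" if k: "k \<ge> 1" for k
  proof -
    define c where "c = R * real k powr \<alpha>"
    define p where "p = measure law {y. 4 * c < norm y}"
    have p: "0 \<le> p" "p \<le> 1" by (auto simp: p_def)
    have c: "c > 0" using R(1) k by (simp add: c_def)
    have "(D.P ^^ j) (indicat_real {x. norm x \<le> c}) 0 \<ge> 1 - 1 / 10" if "j \<le> k" for j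
    proof -
      have "R * real j powr \<alpha> \<le> c" unfolding c_def
        using R(1) \<alpha> that by (intro mult_left_mono powr_mono2) auto
      from R(2)[OF this] show ?thesis by simp
    qed
    from D.P_pow_large_lower[OF this, where x = 0] c
    have "(1 - 1 / 10) * (1 - (1 - p) ^ k) \<le> (D.P ^^ k) (indicat_real {x. c < norm x}) 0"
      by (simp add: p_def)
    also have "\<dots> = prob {\<omega>\<in>space M. c < norm (walk k \<omega>)}" by (simp add: P_pow_indicator)
    also have "\<dots> = 1 - prob {\<omega>\<in>space M. norm (walk k \<omega>) \<le> c}"
      by (subst prob_compl[symmetric]) (auto intro!: arg_cong[where f = prob])
    also have "\<dots> \<le> 1 / 10"
      using R(2)[of k c] by (simp add: c_def P_pow_indicator)
    finally have "8 / 9 \<le> (1 - p) ^ k" by simp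
    \<comment> \<open>Since \<open>(1 + p) ^ k * (1 - p) ^ k\<close> is at most 1, Bernoulli's
      inequality converts the lower bound 8/9 for \<open>(1 - p) ^ k\<close> into
      \<open>k * p \<le> 1 / 8\<close>.\<close>
    moreover have "1 + real k * p \<le> (1 + p) ^ k"
      using Bernoulli_inequality[of p k] p by (simp add: mult.commute)
    ultimately have "(1 + real k * p) * (8 / 9) \<le> (1 + p) ^ k * (1 - p) ^ k"
      using p by (intro mult_mono) auto
    also have "\<dots> = (1 - p\<^sup>2) ^ k"
      by (simp add: power2_eq_square algebra_simps flip: power_mult_distrib)
    also have "\<dots> \<le> 1"
      using p by (intro power_le_one) (auto simp: power_le_one)
    finally show ?thesis by (simp add: p_def c_def)
  qed
  define K where "K = (4 * R) powr (1 / \<alpha>)"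
  have "measure law {y. x < norm y} \<le> K * x powr (- (1 / \<alpha>))" if x: "x > 0" for x
  proof -
    define z where "z = (x / (4 * R)) powr (1 / \<alpha>)"
    have z: "z > 0" using x R(1) by (simp add: z_def)
    have "1 / z = K * x powr (- (1 / \<alpha>))"
      using x R(1) by (simp add: z_def K_def powr_divide powr_minus divide_simps)
    moreover have "measure law {y. x < norm y} \<le> 1 / z"
    proof (cases "z < 1")
      case True
      then have "1 \<le> 1 / z" using z by simp
      then show ?thesis using D.prob_le_1[of "{y. x < norm y}"] by linarith
    next
      case False
      \<comment> \<open>\<open>z\<close> is the real number of steps whose scale
        \<open>4 * R * z powr \<alpha>\<close> is exactly \<open>x\<close>. Rounding down costs at
        most a factor 2, which the 1/8 in \<open>tail\<close> absorbs.\<close>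
      define k where "k = nat \<lfloor>z\<rfloor>"
      have k: "1 \<le> k" "real k \<le> z" "z \<le> 2 * real k"
      proof -
        have "real k = of_int \<lfloor>z\<rfloor>" using False by (simp add: k_def)
        moreover have "1 \<le> \<lfloor>z\<rfloor>" using False by simp
        ultimately show "1 \<le> k" "real k \<le> z" "z \<le> 2 * real k"
          unfolding k_def by linarith+
      qed
      have "4 * (R * real k powr \<alpha>) \<le> 4 * (R * z powr \<alpha>)"
        using k R(1) \<alpha> by (intro mult_left_mono powr_mono2) auto
      also have "\<dots> = x" using x R(1) \<alpha> by (simp add: z_def powr_powr)
      finally have "measure law {y. x < norm y} \<le> measure law {y. 4 * (R * real k powr \<alpha>) < norm y}"
        by (intro D.finite_measure_mono) auto
      also have "\<dots> \<le> 1 / (8 * real k)" using tail[OF k(1)] k(1) by (simp add: field_simps)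
      also have "\<dots> \<le> 1 / z" using k z by (intro divide_left_mono) auto
      finally show ?thesis .
    qed
    ultimately show ?thesis by simp
  qed
  moreover have "K > 0" using R(1) by (simp add: K_def)
  ultimately show ?thesis by blast
qed

text \<open>Bounded and subadditive, so that \<open>expectation_avg_subadditive\<close> applies
  whatever the tail of the steps.\<close>

definition trunc :: "real \<Rightarrow> 'd \<Rightarrow> real" where
  "trunc y x = min 1 (norm x / y)"

lemma bounded_borel_trunc: "y > 0 \<Longrightarrow> bounded_borel 1 (trunc y)"
  unfolding bounded_borel_def trunc_def[abs_def] by auto

lemma trunc_add: "y > 0 \<Longrightarrow> trunc y (u + v) \<le> trunc y u + trunc y v"
proof -
  assume "y > 0"
  then have "norm (u + v) / y \<le> norm u / y + norm v / y" "0 \<le> norm u / y" "0 \<le> norm v / y"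
    using norm_triangle_ineq[of u v] by (auto simp: divide_right_mono simp flip: add_divide_distrib)
  then show ?thesis unfolding trunc_def by linarith
qed

text \<open>Cut at \<open>norm x = sqrt y\<close>. Shorter steps contribute at most
  \<open>sqrt y / y\<close>, longer ones at most their probability, which \<open>step_tail\<close>
  bounds by a multiple of \<open>y powr (- 1 / (2 * \<alpha>))\<close>; \<delta> is the smaller
  exponent.\<close>

lemma step_trunc:
  "\<exists>K>0. \<exists>\<delta>>0. \<forall>y\<ge>1. D.P (trunc y) 0 \<le> K * y powr (- \<delta>)"
proof -
  from step_tail obtain K where K: "K > 0"
    "\<And>x. x > 0 \<Longrightarrow> measure law {y. x < norm y} \<le> K * x powr (- (1 / \<alpha>))" by blast
  define \<delta> where "\<delta> = min (1 / (2 * \<alpha>)) (1 / 2)"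
  have "\<delta> > 0" using \<alpha> by (simp add: \<delta>_def)
  moreover have "D.P (trunc y) 0 \<le> (K + 1) * y powr (- \<delta>)" if y: "y \<ge> 1" for y
  proof -
    let ?A = "{x::'d. sqrt y < norm x}"
    have intA: "integrable law (indicat_real ?A)"
      by (intro integrable_real_indicator) (auto simp: D.emeasure_eq_measure)
    have "D.P (trunc y) 0 = (\<integral>x. trunc y x \<partial>law)" by (simp add: D.P_def)
    also have "\<dots> \<le> (\<integral>x. indicat_real ?A x + sqrt y / y \<partial>law)"
    proof (rule integral_mono)
      show "integrable law (trunc y)"
        using y by (intro D.integrable_bounded_borel[OF bounded_borel_trunc]) auto
      show "integrable law (\<lambda>x. indicat_real ?A x + sqrt y / y)" using intA by simp
      show "trunc y x \<le> indicat_real ?A x + sqrt y / y" for x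
      proof (cases "sqrt y < norm x")
        case True
        then show ?thesis using y by (simp add: trunc_def min.coboundedI1)
      next
        case False
        then have "norm x / y \<le> sqrt y / y" using y by (intro divide_right_mono) auto
        then show ?thesis using False by (simp add: trunc_def min.coboundedI2)
      qed
    qed
    also have "\<dots> = measure law ?A + sqrt y / y"
      using intA by (simp add: D.prob_space)
    also have "\<dots> \<le> K * sqrt y powr (- (1 / \<alpha>)) + sqrt y / y"
      using K(2)[of "sqrt y"] y by simp
    also have "sqrt y powr (- (1 / \<alpha>)) = y powr (- (1 / (2 * \<alpha>)))"
      using y by (simp add: powr_half_sqrt[symmetric] powr_powr)
    also have "sqrt y / y = y powr (- (1 / 2))"
      using y by (simp add: powr_half_sqrt[symmetric] powr_minus_divide divide_simps flip: powr_add)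
    also have "K * y powr (- (1 / (2 * \<alpha>))) + y powr (- (1 / 2)) \<le> K * y powr (- \<delta>) + y powr (- \<delta>)"
      using y K(1) by (intro add_mono mult_left_mono powr_mono) (auto simp: \<delta>_def)
    finally show ?thesis by (simp add: algebra_simps)
  qed
  ultimately show ?thesis using K(1) by (intro exI[of _ "K + 1"]) auto
qed

text \<open>For \<open>j\<close> close to \<open>L\<close> the scale \<open>L powr \<alpha>\<close>
  is a small dilation of \<open>j powr \<alpha>\<close>, where the limit law is known. For other
  \<open>j\<close> the trivial bound \<open>2 * K\<close> is absorbed by the quadratic term, in the
  form that \<open>H_quadratic_error\<close> takes.\<close>

lemma P_pow_scaled_error:
  assumes f: "test_function K R f" and \<epsilon>: "\<epsilon> > 0"
  shows "\<exists>C\<ge>0. \<exists>L0>0. \<forall>L\<ge>L0. \<forall>j. \<bar>(D.P ^^ j) (\<lambda>x. f (x /\<^sub>R (L powr \<alpha>))) 0 - integral\<^sup>L \<nu> f\<bar>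
           \<le> \<epsilon> + C / L\<^sup>2 * (real j - L)\<^sup>2"
proof -
  define c where "c = integral\<^sup>L \<nu> f"
  have K: "K \<ge> 0" "R \<ge> 0" "\<And>x. \<bar>f x\<bar> \<le> K" using f by (auto simp: test_function_def)
  have fc: "continuous_on UNIV f"
    using f by (intro lipschitz_on_continuous_on[of K] lipschitz_onI)
      (auto simp: test_function_def dist_real_def)
  note fb = test_function_bounded_borel[OF f]
  from tendstoD[OF P_pow_conv[OF fc K(3)], of "\<epsilon> / 2"] \<epsilon> obtain k0 where
    k0: "\<And>k. k \<ge> k0 \<Longrightarrow> \<bar>(D.P ^^ k) (\<lambda>x. f (x /\<^sub>R (real k powr \<alpha>))) 0 - c\<bar> \<le> \<epsilon> / 2"
    by (fastforce simp: eventually_sequentially dist_real_def c_def)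
  \<comment> \<open>The cap at one half makes the dilation lemma applicable; the other entry keeps
    the dilation error below \<open>\<epsilon> / 2\<close>, with \<open>+ 1\<close> guarding against
    a zero denominator.\<close>
  define \<beta> where "\<beta> = min (1 / 2) (\<epsilon> / (2 * (2 * R * K + 1)))"
  have RK: "0 \<le> R * K" using K by simp
  then have \<beta>: "\<beta> > 0" using \<epsilon> by (auto simp: \<beta>_def intro!: divide_pos_pos)
  have "isCont (\<lambda>t::real. t powr \<alpha>) 1" by (intro continuous_intros) auto
  then have "(\<lambda>t::real. t powr \<alpha>) \<midarrow>1\<rightarrow> 1" by (simp add: isCont_def)
  from LIM_D[OF this \<beta>] obtain \<eta> where \<eta>: "\<eta> > 0"
    "\<And>t::real. t \<noteq> 1 \<Longrightarrow> \<bar>t - 1\<bar> < \<eta> \<Longrightarrow> \<bar>t powr \<alpha> - 1\<bar> < \<beta>" by auto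
  define \<theta> where "\<theta> = min (1 / 2) (\<eta> / 2)"
  have \<theta>: "\<theta> > 0" "\<theta> \<le> 1 / 2" "\<theta> < \<eta>" using \<eta>(1) by (auto simp: \<theta>_def)
  have \<theta>': "\<bar>t powr \<alpha> - 1\<bar> \<le> \<beta>" if "\<bar>t - 1\<bar> \<le> \<theta>" for t :: real
    using \<eta>(2)[of t] that \<theta>(3) \<beta> by (cases "t = 1") auto
  have "\<bar>(D.P ^^ j) (\<lambda>x. f (x /\<^sub>R (L powr \<alpha>))) 0 - c\<bar> \<le> \<epsilon> + 2 * K / \<theta>\<^sup>2 / L\<^sup>2 * (real j - L)\<^sup>2"
    if L: "L \<ge> 2 * real k0 + 1" for L j
  proof (cases "\<bar>real j - L\<bar> \<le> \<theta> * L")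
    case True
    have L0: "L > 0" using L by linarith
    have "\<theta> * L \<le> 1 / 2 * L" using \<theta>(2) L0 by (intro mult_right_mono) auto
    then have j: "real j \<ge> L / 2" using True by linarith
    then have jk: "j \<ge> k0" "real j > 0" using L by linarith+
    define s where "s = (real j / L) powr \<alpha>"
    have "\<bar>real j / L - 1\<bar> = \<bar>real j - L\<bar> / L" using L0 by (simp add: field_simps abs_divide)
    also have "\<dots> \<le> \<theta>" using True L0 by (simp add: field_simps)
    finally have s: "\<bar>s - 1\<bar> \<le> \<beta>" unfolding s_def by (rule \<theta>')
    then have s2: "1 / 2 \<le> s" unfolding \<beta>_def by linarith
    have scale: "x /\<^sub>R (L powr \<alpha>) = s *\<^sub>R (x /\<^sub>R (real j powr \<alpha>))" for x :: 'd
      using L0 jk by (simp add: s_def powr_divide field_simps)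
    have pw: "\<bar>f (x /\<^sub>R (L powr \<alpha>)) - f (x /\<^sub>R (real j powr \<alpha>))\<bar> \<le> \<epsilon> / 2" for x
    proof -
      have "\<bar>f (x /\<^sub>R (L powr \<alpha>)) - f (x /\<^sub>R (real j powr \<alpha>))\<bar> \<le> 2 * R * K * \<bar>s - 1\<bar>"
        unfolding scale by (rule test_function_dilation[OF f s2])
      also have "\<dots> \<le> 2 * R * K * (\<epsilon> / (2 * (2 * R * K + 1)))"
      proof (rule mult_left_mono)
        show "\<bar>s - 1\<bar> \<le> \<epsilon> / (2 * (2 * R * K + 1))" using s unfolding \<beta>_def by linarith
        show "0 \<le> 2 * R * K" using K by simp
      qed
      also have "\<dots> \<le> \<epsilon> / 2" using RK \<epsilon> by (simp add: field_simps)
      finally show ?thesis .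
    qed
    have "\<bar>(D.P ^^ j) (\<lambda>x. f (x /\<^sub>R (L powr \<alpha>))) 0 - (D.P ^^ j) (\<lambda>x. f (x /\<^sub>R (real j powr \<alpha>))) 0\<bar>
        = \<bar>expectation (\<lambda>\<omega>. f (walk j \<omega> /\<^sub>R (L powr \<alpha>)) - f (walk j \<omega> /\<^sub>R (real j powr \<alpha>)))\<bar>"
    proof -
      have "integrable M (\<lambda>\<omega>. f (walk j \<omega> /\<^sub>R a))" for a
        using bounded_borelD[OF fb[of a]]
        by (intro integrable_bounded[of _ K] measurable_compose[OF measurable_walk]) auto
      then show ?thesis by (simp add: expectation_walk[OF fb, symmetric])
    qed
    also have "\<dots> \<le> \<epsilon> / 2"
    proof -
      have m: "(\<lambda>\<omega>. f (walk j \<omega> /\<^sub>R a)) \<in> borel_measurable M" for a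
        by (rule measurable_compose[OF measurable_walk bounded_borelD(1)[OF fb]])
      have "\<bar>expectation (\<lambda>\<omega>. f (walk j \<omega> /\<^sub>R (L powr \<alpha>)) - f (walk j \<omega> /\<^sub>R (real j powr \<alpha>)))\<bar>
          \<le> expectation (\<lambda>\<omega>. \<bar>f (walk j \<omega> /\<^sub>R (L powr \<alpha>)) - f (walk j \<omega> /\<^sub>R (real j powr \<alpha>))\<bar>)"
        by (rule integral_abs_bound)
      also have "\<dots> \<le> expectation (\<lambda>\<omega>. \<epsilon> / 2)"
        using pw m \<epsilon> by (intro integral_mono integrable_bounded[of _ "\<epsilon> / 2"]) auto
      finally show ?thesis by (simp add: prob_space)
    qed
    finally have "\<bar>(D.P ^^ j) (\<lambda>x. f (x /\<^sub>R (L powr \<alpha>))) 0 - c\<bar> \<le> \<epsilon>"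
      using k0[OF jk(1)] by linarith
    moreover have "0 \<le> 2 * K / \<theta>\<^sup>2 / L\<^sup>2 * (real j - L)\<^sup>2" using K by simp
    ultimately show ?thesis by linarith
  next
    case False
    have L0: "L > 0" using L by linarith
    interpret \<nu>: prob_space \<nu> by (rule \<nu>(1))
    have int: "integrable \<nu> f" by (rule integrable_bounded_continuous[OF \<nu> fc K(3)])
    have "\<bar>c\<bar> \<le> (\<integral>x. \<bar>f x\<bar> \<partial>\<nu>)" unfolding c_def by (rule integral_abs_bound)
    also have "\<dots> \<le> (\<integral>x. K \<partial>\<nu>)" using int K by (intro integral_mono) auto
    finally have "\<bar>c\<bar> \<le> K" by (simp add: \<nu>.prob_space)
    moreover have "\<bar>(D.P ^^ j) (\<lambda>x. f (x /\<^sub>R (L powr \<alpha>))) 0\<bar> \<le> K"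
      by (rule bounded_borelD(2)[OF D.bounded_borel_P_pow[OF fb]])
    ultimately have "\<bar>(D.P ^^ j) (\<lambda>x. f (x /\<^sub>R (L powr \<alpha>))) 0 - c\<bar> \<le> 2 * K" by linarith
    also have "\<dots> \<le> 2 * K / \<theta>\<^sup>2 / L\<^sup>2 * (real j - L)\<^sup>2"
    proof -
      have "(\<theta> * L)\<^sup>2 \<le> \<bar>real j - L\<bar>\<^sup>2" using False \<theta>(1) L0 by (intro power_mono) auto
      then have "2 * K * (\<theta> * L)\<^sup>2 \<le> 2 * K * (real j - L)\<^sup>2" using K by (intro mult_left_mono) auto
      then show ?thesis using \<theta>(1) L0 by (simp add: field_simps power_mult_distrib)
    qed
    finally show ?thesis using \<epsilon> by linarith
  qed
  then show ?thesis
    unfolding c_def using K by (intro exI[of _ "2 * K / \<theta>\<^sup>2"] conjI exI[of _ "2 * real k0 + 1"]) auto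
qed

text \<open>With \<open>L = ln (m + l)\<close>, the mean depth misses \<open>L\<close> by at most
  \<open>ln m + 1\<close> and the variance is at most \<open>L\<close>. Division by
  \<open>L^2\<close> leaves the two error terms.\<close>

lemma H_scaled_error:
  assumes f: "test_function K R f" and \<epsilon>: "\<epsilon> > 0"
  shows "\<exists>C\<ge>0. \<exists>L0>0. \<forall>m\<ge>1. \<forall>l. L0 \<le> ln (real (m + l)) \<longrightarrow>
      \<bar>D.H m l (\<lambda>x. f (x /\<^sub>R (ln (real (m + l)) powr \<alpha>))) 0 - integral\<^sup>L \<nu> f\<bar>
        \<le> \<epsilon> + C * (((ln (real m) + 1) / ln (real (m + l)))\<^sup>2 + 1 / ln (real (m + l)))"
proof -
  from P_pow_scaled_error[OF f \<epsilon>] obtain C L0 where C: "C \<ge> 0" "L0 > 0"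
    "\<And>L j. L \<ge> L0 \<Longrightarrow> \<bar>(D.P ^^ j) (\<lambda>x. f (x /\<^sub>R (L powr \<alpha>))) 0 - integral\<^sup>L \<nu> f\<bar>
           \<le> \<epsilon> + C / L\<^sup>2 * (real j - L)\<^sup>2" by blast
  have "\<bar>D.H m l (\<lambda>x. f (x /\<^sub>R (ln (real (m + l)) powr \<alpha>))) 0 - integral\<^sup>L \<nu> f\<bar>
        \<le> \<epsilon> + C * (((ln (real m) + 1) / ln (real (m + l)))\<^sup>2 + 1 / ln (real (m + l)))"
    if m: "m \<ge> 1" and L0: "L0 \<le> ln (real (m + l))" for m l
  proof -
    define L where "L = ln (real (m + l))"
    define \<mu> where "\<mu> = (\<Sum>k=m..<m+l. 1 / real (Suc k))"
    have L: "L > 0" "L \<ge> L0" using C(2) L0 by (auto simp: L_def)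
    have \<mu>: "\<mu> \<le> L - ln (real m)" "L - ln (real m) - 1 \<le> \<mu>"
      using sum_inverse_Suc_bounds[OF m, of l] by (auto simp: \<mu>_def L_def)
    have lm: "ln (real m) \<ge> 0" using m by simp
    have "\<bar>(D.P ^^ 0) (D.H m l (\<lambda>x. f (x /\<^sub>R (L powr \<alpha>)))) 0 - integral\<^sup>L \<nu> f\<bar>
        \<le> \<epsilon> + C / L\<^sup>2 * ((real 0 + \<mu> - L)\<^sup>2 + \<mu>)"
      unfolding \<mu>_def using C(1)
      by (intro D.H_quadratic_error[OF test_function_bounded_borel[OF f]] C(3)[OF L(2)]) auto
    also have "\<dots> \<le> \<epsilon> + C / L\<^sup>2 * ((ln (real m) + 1)\<^sup>2 + L)"
    proof -
      have "\<bar>real 0 + \<mu> - L\<bar>\<^sup>2 \<le> (ln (real m) + 1)\<^sup>2" using \<mu> lm by (intro power_mono) auto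
      then have "(real 0 + \<mu> - L)\<^sup>2 \<le> (ln (real m) + 1)\<^sup>2" by (simp only: power2_abs)
      moreover have "\<mu> \<le> L" using \<mu> lm by linarith
      ultimately show ?thesis using C(1) by (intro add_left_mono mult_left_mono add_mono) auto
    qed
    also have "\<dots> = \<epsilon> + C * (((ln (real m) + 1) / L)\<^sup>2 + 1 / L)"
      using L(1) by (simp add: field_simps power2_eq_square)
    finally show ?thesis by (simp add: L_def)
  qed
  then show ?thesis using C(1,2) by blast
qed

end

section \<open>Almost sure convergence\<close>

lemma dyadic_block_index:
  obtains J :: "nat \<Rightarrow> nat"
  where "\<And>i::nat. i \<ge> 1 \<Longrightarrow> 2 ^ J i \<le> i" "\<And>i::nat. i \<ge> 1 \<Longrightarrow> i < 2 ^ Suc (J i)" "filterlim J at_top at_top"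
proof -
  have "\<exists>n. i \<ge> 1 \<longrightarrow> 2 ^ n \<le> i \<and> i < 2 ^ Suc n" for i :: nat
    using ex_power_ivl1[of 2 i] by auto
  then obtain J :: "nat \<Rightarrow> nat" where J: "\<And>i. i \<ge> 1 \<longrightarrow> 2 ^ J i \<le> i \<and> i < 2 ^ Suc (J i)"
    by metis
  have "filterlim J at_top at_top"
    unfolding filterlim_at_top
  proof
    fix N
    show "\<forall>\<^sub>F i in at_top. N \<le> J i"
      using eventually_ge_at_top[of "2 ^ N :: nat"]
    proof eventually_elim
      case (elim i)
      then have "i \<ge> 1" by (meson le_trans one_le_numeral one_le_power)
      with J have "i < 2 ^ Suc (J i)" by blast
      with elim have "(2::nat) ^ N < 2 ^ Suc (J i)" by linarith
      then have "N < Suc (J i)" by (rule power_less_imp_less_exp[rotated]) simp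
      then show ?case by simp
    qed
  qed
  with J that show ?thesis by blast
qed

definition block_end :: "nat \<Rightarrow> nat" where
  "block_end i = nat \<lceil>exp (sqrt (real i))\<rceil>"

lemma block_end_ge: "exp (sqrt (real i)) \<le> real (block_end i)"
  unfolding block_end_def by linarith

lemma block_end_pos: "block_end i \<ge> 1"
proof -
  have "1 \<le> exp (sqrt (real i))" by simp
  also note block_end_ge
  finally show ?thesis by simp
qed

lemma ln_block_end_ge: "sqrt (real i) \<le> ln (real (block_end i))"
  using block_end_ge[of i] block_end_pos[of i] by (subst ln_ge_iff) auto

context scaled_random_recursive_walk
begin

text \<open>A lower bound \<open>y\<close> may replace the scale \<open>a\<close>. Taking
  \<open>y\<close> constant on a dyadic block makes the right-hand side the same for all sizes of
  the block.\<close>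

lemma avg_shift_error:
  assumes f: "test_function K R f" and a: "0 < y" "y \<le> a" and m: "m \<ge> 1"
  shows "\<bar>avg m (D.H m l (\<lambda>x. f (x /\<^sub>R a))) \<omega> - D.H m l (\<lambda>x. f (x /\<^sub>R a)) 0\<bar> \<le> 2 * K * avg m (trunc y) \<omega>"
proof -
  let ?h = "D.H m l (\<lambda>x. f (x /\<^sub>R a))"
  have K: "K \<ge> 0" using f by (simp add: test_function_def)
  have pt: "\<bar>?h x - ?h 0\<bar> \<le> 2 * K * trunc y x" for x
  proof -
    have "\<bar>f ((x + z) /\<^sub>R a) - f (z /\<^sub>R a)\<bar> \<le> 2 * K * trunc y x" for z
    proof -
      have "\<bar>f (x /\<^sub>R a + z /\<^sub>R a) - f (z /\<^sub>R a)\<bar> \<le> 2 * K * min 1 (norm (x /\<^sub>R a))"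
        by (rule test_function_shift[OF f])
      also have "norm (x /\<^sub>R a) = norm x / a" using a by (simp add: divide_inverse mult.commute)
      also have "2 * K * min 1 (norm x / a) \<le> 2 * K * min 1 (norm x / y)"
        using K a by (intro mult_left_mono min.mono divide_left_mono) auto
      finally show ?thesis by (simp add: scaleR_add_right trunc_def)
    qed
    from D.H_shift_bound[OF test_function_bounded_borel[OF f] this, of m l 0]
    show ?thesis by simp
  qed
  have "avg m ?h \<omega> - ?h 0 = (\<Sum>i=1..m. ?h (pos i \<omega>) - ?h 0) / real m"
    using m by (simp add: avg_def sum_subtractf diff_divide_distrib)
  also have "\<bar>\<dots>\<bar> \<le> (\<Sum>i=1..m. 2 * K * trunc y (pos i \<omega>)) / real m"
    unfolding abs_divide abs_of_nat
    by (intro divide_right_mono order_trans[OF sum_abs] sum_mono pt of_nat_0_le_iff)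
  also have "\<dots> = 2 * K * avg m (trunc y) \<omega>"
    by (simp add: avg_def sum_distrib_left)
  finally show ?thesis .
qed

text \<open>For \<open>i\<close> in block \<open>j\<close> the logarithm of
  \<open>block_end i\<close> is at least \<open>sqrt (2 ^ j)\<close>, so this is a lower bound for
  all scales of the block.\<close>

definition block_scale :: "nat \<Rightarrow> real" where
  "block_scale j = (2 ^ j) powr (\<alpha> / 2)"

lemma block_scale_ge_1: "block_scale j \<ge> 1"
  unfolding block_scale_def using \<alpha> by (intro ge_one_powr_ge_zero) auto

text \<open>A sum of squares dominates the largest one and has a computable mean. The guard drops
  sizes smaller than the starting tree, for which the difference \<open>block_end i - 4 ^ j\<close>
  would be cut off at 0.\<close>

definition block_error :: "('d \<Rightarrow> real) \<Rightarrow> nat \<Rightarrow> 's \<Rightarrow> real" where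
  "block_error f j \<omega> = (\<Sum>i\<in>{2^j..<2^Suc j}. if 4 ^ j \<le> block_end i
     then (let g = (\<lambda>x. f (x /\<^sub>R (ln (real (block_end i)) powr \<alpha>)))
           in (avg (block_end i) g \<omega> - avg (4 ^ j) (D.H (4 ^ j) (block_end i - 4 ^ j) g) \<omega>)\<^sup>2)
     else 0)"

text \<open>Block \<open>j\<close> has \<open>2 ^ j\<close> terms with mean at most
  \<open>4 * K^2 / 4 ^ j\<close>, so the block means decay like \<open>2 ^ (-j)\<close>.\<close>

lemma AE_block_error:
  assumes f: "test_function K R f"
  shows "AE \<omega> in M. (\<lambda>j. block_error f j \<omega>) \<longlonglongrightarrow> 0"
proof (rule AE_tendsto_0_if_summable_expectation)
  define g where "g i = (\<lambda>x. f (x /\<^sub>R (ln (real (block_end i)) powr \<alpha>)))" for i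
  define Y where "Y j i \<omega> = (if 4 ^ j \<le> block_end i
    then (avg (block_end i) (g i) \<omega> - avg (4 ^ j) (D.H (4 ^ j) (block_end i - 4 ^ j) (g i)) \<omega>)\<^sup>2 else 0)" for j i \<omega>
  have gb: "bounded_borel K (g i)" for i unfolding g_def by (rule test_function_bounded_borel[OF f])
  have eq: "block_error f j = (\<lambda>\<omega>. \<Sum>i\<in>{2^j..<2^Suc j}. Y j i \<omega>)" for j
    unfolding block_error_def[abs_def] Y_def g_def Let_def ..
  note m [measurable] = avg_measurable[OF gb] avg_measurable[OF D.bounded_borel_H[OF gb]]
  have K: "K \<ge> 0" using f by (simp add: test_function_def)
  have intY: "integrable M (Y j i)" for i j
  proof (rule integrable_bounded)
    show "Y j i \<in> borel_measurable M" unfolding Y_def[abs_def] by measurable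
    show "\<bar>Y j i \<omega>\<bar> \<le> (2 * K) * (2 * K)" for \<omega>
    proof -
      have "\<bar>avg (block_end i) (g i) \<omega> - avg (4 ^ j) (D.H (4 ^ j) (block_end i - 4 ^ j) (g i)) \<omega>\<bar> \<le> 2 * K"
        using avg_bound[OF gb, of "block_end i" i \<omega>]
          avg_bound[OF D.bounded_borel_H[OF gb], of "4 ^ j" "4 ^ j" "block_end i - 4 ^ j" i \<omega>] by linarith
      from abs_mult_le[OF this this] K show ?thesis by (auto simp: Y_def power2_eq_square)
    qed
  qed
  have Y: "expectation (Y j i) \<le> 4 * K\<^sup>2 / 4 ^ j" for i j
  proof (cases "4 ^ j \<le> block_end i")
    case True
    then have "expectation (Y j i) \<le> 4 * K\<^sup>2 * (1 / real (4 ^ j) - 1 / real (4 ^ j + (block_end i - 4 ^ j)))"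
      using avg_variance[OF _ gb, of "4 ^ j" "block_end i - 4 ^ j" i] by (simp add: Y_def[abs_def])
    also have "\<dots> \<le> 4 * K\<^sup>2 * (1 / real (4 ^ j))" by (intro mult_left_mono) auto
    finally show ?thesis by simp
  qed (simp add: Y_def[abs_def])
  show int: "integrable M (block_error f j)" for j
    unfolding eq using intY by (intro Bochner_Integration.integrable_sum)
  show nn: "0 \<le> block_error f j \<omega>" for j \<omega>
    unfolding eq Y_def by (intro sum_nonneg) auto
  show "summable (\<lambda>j. expectation (block_error f j))"
  proof (rule summable_comparison_test)
    show "summable (\<lambda>j. 4 * K\<^sup>2 * (1 / 2) ^ j)" by (intro summable_mult summable_geometric) simp
    have "norm (expectation (block_error f j)) \<le> 4 * K\<^sup>2 * (1 / 2) ^ j" for j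
    proof -
      have "expectation (block_error f j) = (\<Sum>i\<in>{2^j..<2^Suc j}. expectation (Y j i))"
        unfolding eq using intY by (intro Bochner_Integration.integral_sum)
      also have "\<dots> \<le> real (card {2^j..<2^Suc j::nat}) * (4 * K\<^sup>2 / 4 ^ j)"
        using Y by (intro sum_bounded_above) auto
      also have "\<dots> = 4 * K\<^sup>2 * (2 / 4) ^ j" unfolding power_divide by simp
      finally show ?thesis using nn by (simp add: integral_nonneg)
    qed
    then show "\<exists>N. \<forall>j\<ge>N. norm (expectation (block_error f j)) \<le> 4 * K\<^sup>2 * (1 / 2) ^ j" by blast
  qed
qed

text \<open>The mean number of steps \<open>harm (4 ^ j)\<close> grows only linearly in
  \<open>j\<close>, while the truncated mean of one step at scale \<open>block_scale j\<close>
  decays geometrically.\<close>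

lemma AE_trunc_avg: "AE \<omega> in M. (\<lambda>j. avg (4 ^ j) (trunc (block_scale j)) \<omega>) \<longlonglongrightarrow> 0"
proof (rule AE_tendsto_0_if_summable_expectation)
  have y: "block_scale j > 0" for j using block_scale_ge_1[of j] by linarith
  note b = bounded_borel_trunc[OF y]
  show int: "integrable M (avg (4 ^ j) (trunc (block_scale j)))" for j
    by (rule integrable_bounded[OF avg_measurable[OF b] avg_bound[OF b]])
  show nn: "0 \<le> avg (4 ^ j) (trunc (block_scale j)) \<omega>" for j \<omega>
    unfolding avg_def trunc_def using y[of j] by (intro divide_nonneg_nonneg sum_nonneg) auto
  from step_trunc obtain K \<delta> where K: "K > 0" "\<delta> > 0" "\<And>y. y \<ge> 1 \<Longrightarrow> D.P (trunc y) 0 \<le> K * y powr (- \<delta>)"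
    by blast
  define \<rho> :: real where "\<rho> = 2 powr (- (\<alpha> * \<delta> / 2))"
  have \<rho>: "0 < \<rho>" "\<rho> < 1" using \<alpha> K(2) by (auto simp: \<rho>_def powr_less_one)
  show "summable (\<lambda>j. expectation (avg (4 ^ j) (trunc (block_scale j))))"
  proof (rule summable_comparison_test)
    show "summable (\<lambda>j. 3 * K * (real (Suc j) * \<rho> ^ j))"
      using geometric_deriv_sums[of \<rho>] \<rho> by (intro summable_mult) (auto simp: sums_iff)
    have "norm (expectation (avg (4 ^ j) (trunc (block_scale j)))) \<le> 3 * K * (real (Suc j) * \<rho> ^ j)" for j
    proof -
      have "block_scale j powr (- \<delta>) = \<rho> ^ j"
        by (simp add: block_scale_def \<rho>_def powr_powr powr_power mult_ac flip: powr_realpow)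
      then have P: "D.P (trunc (block_scale j)) 0 \<le> K * \<rho> ^ j"
        using K(3)[OF block_scale_ge_1[of j]] by simp
      have "ln (4::real) \<le> 3" using ln_le_minus_one[of "4::real"] by simp
      then have "real j * ln 4 \<le> real j * 3" by (intro mult_left_mono) auto
      then have h: "harm (4 ^ j) \<le> 3 * real (Suc j)"
        using harm_le_ln[of "4 ^ j"] by (simp add: ln_realpow)
      have "expectation (avg (4 ^ j) (trunc (block_scale j))) \<le> harm (4 ^ j) * D.P (trunc (block_scale j)) 0"
        by (rule expectation_avg_subadditive[OF b trunc_add[OF y]]) simp
      also have "\<dots> \<le> harm (4 ^ j) * (K * \<rho> ^ j)"
        using P by (intro mult_left_mono harm_nonneg)
      also have "\<dots> \<le> 3 * real (Suc j) * (K * \<rho> ^ j)"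
        using h K(1) \<rho>(1) by (intro mult_right_mono) auto
      finally show ?thesis using nn by (simp add: integral_nonneg mult_ac)
    qed
    then show "\<exists>N. \<forall>j\<ge>N. norm (expectation (avg (4 ^ j) (trunc (block_scale j)))) \<le> 3 * K * (real (Suc j) * \<rho> ^ j)"
      by blast
  qed
qed

text \<open>Three errors are added: the martingale difference, the displacement of the starting
  positions from the origin, and the fluctuation of the depth together with the distance to the
  limit law.\<close>

lemma block_avg_tendsto:
  assumes f: "test_function K R f"
    and V: "(\<lambda>j. block_error f j \<omega>) \<longlonglongrightarrow> 0"
    and A: "(\<lambda>j. avg (4 ^ j) (trunc (block_scale j)) \<omega>) \<longlonglongrightarrow> 0"
  shows "(\<lambda>i. avg (block_end i) (\<lambda>x. f (x /\<^sub>R (ln (real (block_end i)) powr \<alpha>))) \<omega>) \<longlonglongrightarrow> integral\<^sup>L \<nu> f"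
proof (rule tendstoI)
  fix \<epsilon> :: real assume \<epsilon>: "\<epsilon> > 0"
  obtain J where J: "\<And>i::nat. i \<ge> 1 \<Longrightarrow> 2 ^ J i \<le> i" "\<And>i::nat. i \<ge> 1 \<Longrightarrow> i < 2 ^ Suc (J i)" "filterlim J at_top at_top"
    by (rule dyadic_block_index) blast
  have K: "K \<ge> 0" using f by (simp add: test_function_def)
  from H_scaled_error[OF f half_gt_zero[OF \<epsilon>]] obtain C L0 where C: "C \<ge> 0" "L0 > 0"
    "\<And>m l. m \<ge> 1 \<Longrightarrow> L0 \<le> ln (real (m + l)) \<Longrightarrow>
      \<bar>D.H m l (\<lambda>x. f (x /\<^sub>R (ln (real (m + l)) powr \<alpha>))) 0 - integral\<^sup>L \<nu> f\<bar>
        \<le> \<epsilon> / 2 + C * (((ln (real m) + 1) / ln (real (m + l)))\<^sup>2 + 1 / ln (real (m + l)))"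
    by blast
  \<comment> \<open>Bounds the depth error by means of \<open>ln m \<le> 2 * ln i\<close> and
    \<open>ln n \<ge> sqrt i\<close>.\<close>
  define r where "r i = ((2 * ln (real i) + 1) / sqrt (real i))\<^sup>2 + 1 / sqrt (real i)" for i :: nat
  have "r \<longlonglongrightarrow> 0" unfolding r_def by real_asymp
  then have "(\<lambda>i. sqrt (block_error f (J i) \<omega>) + 2 * K * avg (4 ^ J i) (trunc (block_scale (J i))) \<omega> + C * r i)
      \<longlonglongrightarrow> sqrt 0 + 2 * K * 0 + C * 0"
    by (intro tendsto_intros filterlim_compose[OF V J(3)] filterlim_compose[OF A J(3)])
  then have small: "\<forall>\<^sub>F i in sequentially. sqrt (block_error f (J i) \<omega>)
      + 2 * K * avg (4 ^ J i) (trunc (block_scale (J i))) \<omega> + C * r i < \<epsilon> / 2"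
    using \<epsilon> by (intro order_tendstoD) auto
  \<comment> \<open>Since \<open>4 ^ j\<close> is at most \<open>i^2\<close>, this makes the
    starting tree no larger than \<open>n\<close>, so that the guard in \<open>block_error\<close>
    is satisfied.\<close>
  have "\<forall>\<^sub>F i::nat in sequentially. real i ^ 2 \<le> exp (sqrt (real i))" by real_asymp
  moreover have "\<forall>\<^sub>F i::nat in sequentially. L0 \<le> sqrt (real i)" by real_asymp
  ultimately show "\<forall>\<^sub>F i in sequentially.
      dist (avg (block_end i) (\<lambda>x. f (x /\<^sub>R (ln (real (block_end i)) powr \<alpha>))) \<omega>) (integral\<^sup>L \<nu> f) < \<epsilon>"
    using small eventually_ge_at_top[of "1::nat"]
  proof eventually_elim
    case (elim i)
    define j m n L where "j = J i" "m = (4 ^ j :: nat)" "n = block_end i" "L = ln (real n)"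
    note defs = this
    define g where "g = (\<lambda>x. f (x /\<^sub>R (L powr \<alpha>)))"
    have i: "2 ^ j \<le> i" "i < 2 ^ Suc j" using J(1,2)[OF elim(4)] by (auto simp: defs)
    have m: "m \<ge> 1" by (simp add: defs)
    have "m = (2 ^ j)\<^sup>2" by (simp add: defs power2_eq_square flip: power_mult_distrib)
    also have "\<dots> \<le> i\<^sup>2" using i by (intro power_mono) auto
    finally have mi: "m \<le> i\<^sup>2" .
    then have "real m \<le> (real i)\<^sup>2" by (metis of_nat_le_iff of_nat_power)
    also have "\<dots> \<le> real n" using elim(1) block_end_ge[of i] unfolding defs by linarith
    finally have mn: "m \<le> n" by simp
    have L: "sqrt (real i) \<le> L" using ln_block_end_ge by (simp add: defs)
    have si: "1 \<le> sqrt (real i)" using elim(4) by simp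
    have lm: "ln (real m) \<le> 2 * ln (real i)"
    proof -
      have "ln (real m) \<le> ln ((real i)\<^sup>2)"
        using \<open>real m \<le> (real i)\<^sup>2\<close> m elim(4) by (subst ln_le_cancel_iff) auto
      then show ?thesis using elim(4) by (simp add: ln_realpow)
    qed
    have scale: "block_scale j \<le> L powr \<alpha>"
    proof -
      have "block_scale j \<le> real i powr (\<alpha> / 2)"
        unfolding block_scale_def using i \<alpha> by (intro powr_mono2) (auto simp flip: of_nat_le_iff)
      also have "\<dots> = sqrt (real i) powr \<alpha>"
        by (simp add: powr_half_sqrt[symmetric] powr_powr)
      also have "\<dots> \<le> L powr \<alpha>" using L \<alpha> by (intro powr_mono2) auto
      finally show ?thesis .
    qed
    have "(avg n g \<omega> - avg m (D.H m (n - m) g) \<omega>)\<^sup>2 \<le> block_error f j \<omega>"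
    proof -
      have "(if 4 ^ j \<le> block_end i
        then (let g = (\<lambda>x. f (x /\<^sub>R (ln (real (block_end i)) powr \<alpha>)))
           in (avg (block_end i) g \<omega> - avg (4 ^ j) (D.H (4 ^ j) (block_end i - 4 ^ j) g) \<omega>)\<^sup>2)
        else 0) \<le> block_error f j \<omega>"
        unfolding block_error_def using i by (intro member_le_sum) (auto simp: Let_def)
      then show ?thesis using mn by (simp add: defs g_def Let_def)
    qed
    then have 1: "\<bar>avg n g \<omega> - avg m (D.H m (n - m) g) \<omega>\<bar> \<le> sqrt (block_error f j \<omega>)"
      by (metis real_sqrt_abs real_sqrt_le_mono)
    have 2: "\<bar>avg m (D.H m (n - m) g) \<omega> - D.H m (n - m) g 0\<bar> \<le> 2 * K * avg m (trunc (block_scale j)) \<omega>"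
      unfolding g_def using block_scale_ge_1[of j] by (intro avg_shift_error[OF f _ scale m]) auto
    have 3: "\<bar>D.H m (n - m) g 0 - integral\<^sup>L \<nu> f\<bar> \<le> \<epsilon> / 2 + C * r i"
    proof -
      have "m + (n - m) = n" using mn by simp
      then have "\<bar>D.H m (n - m) g 0 - integral\<^sup>L \<nu> f\<bar> \<le> \<epsilon> / 2 + C * (((ln (real m) + 1) / L)\<^sup>2 + 1 / L)"
        using C(3)[OF m, of "n - m"] elim(2) L by (simp add: g_def defs)
      also have "\<dots> \<le> \<epsilon> / 2 + C * r i"
      proof -
        have "(ln (real m) + 1) / L \<le> (2 * ln (real i) + 1) / sqrt (real i)"
          using lm L si elim(4) by (intro frac_le) auto
        moreover have "0 \<le> (ln (real m) + 1) / L"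
        proof (rule divide_nonneg_nonneg)
          show "0 \<le> L" using L si by linarith
        qed (use m in auto)
        moreover have "1 / L \<le> 1 / sqrt (real i)" using L si by (intro frac_le) auto
        ultimately show ?thesis
          unfolding r_def using C(1) by (intro add_left_mono mult_left_mono add_mono power_mono)
      qed
      finally show ?thesis .
    qed
    have "\<bar>avg n g \<omega> - integral\<^sup>L \<nu> f\<bar> < \<epsilon>"
      using 1 2 3 elim(3) unfolding defs by linarith
    then show ?case by (simp add: g_def defs dist_real_def)
  qed
qed

section \<open>From the block ends to all sizes\<close>

lemma avg_scale_diff:
  assumes f: "test_function K R f" and s: "1 / 2 \<le> a / b" "0 < a" "0 < b"
  shows "\<bar>avg n (\<lambda>x. f (x /\<^sub>R b)) \<omega> - avg n (\<lambda>x. f (x /\<^sub>R a)) \<omega>\<bar> \<le> 2 * R * K * \<bar>a / b - 1\<bar>"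
proof -
  have RK: "0 \<le> 2 * R * K" using f by (simp add: test_function_def)
  have pt: "\<bar>f (x /\<^sub>R b) - f (x /\<^sub>R a)\<bar> \<le> 2 * R * K * \<bar>a / b - 1\<bar>" for x
  proof -
    have "a / b * inverse a = inverse b" using s by (simp add: field_simps)
    then have "(a / b) *\<^sub>R (x /\<^sub>R a) = x /\<^sub>R b" by simp
    then show ?thesis using test_function_dilation[OF f s(1), of "x /\<^sub>R a"] by (simp only:)
  qed
  have "avg n (\<lambda>x. f (x /\<^sub>R b)) \<omega> - avg n (\<lambda>x. f (x /\<^sub>R a)) \<omega>
      = (\<Sum>i=1..n. f (pos i \<omega> /\<^sub>R b) - f (pos i \<omega> /\<^sub>R a)) / real n"
    by (simp add: avg_def sum_subtractf diff_divide_distrib)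
  also have "\<bar>\<dots>\<bar> \<le> (\<Sum>i=1..n. 2 * R * K * \<bar>a / b - 1\<bar>) / real n"
    unfolding abs_divide abs_of_nat
    by (intro divide_right_mono order_trans[OF sum_abs] sum_mono pt of_nat_0_le_iff)
  also have "\<dots> \<le> 2 * R * K * \<bar>a / b - 1\<bar>" using RK by (cases "n = 0") auto
  finally show ?thesis .
qed

text \<open>The nodes after \<open>t\<close> form a fraction \<open>1 - t / n\<close> of the tree;
  discarding them and renormalizing each cost at most \<open>K\<close> times that fraction.\<close>

lemma avg_size_diff:
  assumes g: "bounded_borel K g" and t: "1 \<le> t" "t \<le> n"
  shows "\<bar>avg n g \<omega> - avg t g \<omega>\<bar> \<le> 2 * K * (1 - real t / real n)"
proof -
  have n: "n \<ge> 1" using t by linarith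
  have "{1..n} = {1..t} \<union> {t<..n}" using t by auto
  then have "(\<Sum>i=1..n. g (pos i \<omega>)) = (\<Sum>i=1..t. g (pos i \<omega>)) + (\<Sum>i\<in>{t<..n}. g (pos i \<omega>))"
    by (simp only: sum.union_disjoint[OF finite_atLeastAtMost finite_greaterThanAtMost ivl_disj_int_two(8)])
  then have "avg n g \<omega> = (real t / real n) * avg t g \<omega> + (\<Sum>i\<in>{t<..n}. g (pos i \<omega>)) / real n"
    using t n by (simp add: avg_def add_divide_distrib)
  then have eq: "avg n g \<omega> - avg t g \<omega> = (\<Sum>i\<in>{t<..n}. g (pos i \<omega>)) / real n - (1 - real t / real n) * avg t g \<omega>"
    by (simp add: algebra_simps)
  have b1: "\<bar>(\<Sum>i\<in>{t<..n}. g (pos i \<omega>)) / real n\<bar> \<le> K * (1 - real t / real n)"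
  proof -
    have "\<bar>\<Sum>i\<in>{t<..n}. g (pos i \<omega>)\<bar> \<le> real (card {t<..n}) * K"
      by (rule order_trans[OF sum_abs sum_bounded_above]) (rule bounded_borelD(2)[OF g])
    then have "\<bar>\<Sum>i\<in>{t<..n}. g (pos i \<omega>)\<bar> / real n \<le> (real n - real t) * K / real n"
      using t by (intro divide_right_mono) (auto simp: of_nat_diff)
    then show ?thesis using n by (simp add: abs_divide field_simps)
  qed
  have b2: "\<bar>(1 - real t / real n) * avg t g \<omega>\<bar> \<le> (1 - real t / real n) * K"
    using t n by (intro abs_mult_le avg_bound[OF g]) auto
  have "\<bar>avg n g \<omega> - avg t g \<omega>\<bar> \<le> K * (1 - real t / real n) + (1 - real t / real n) * K"
    unfolding eq by (rule order_trans[OF abs_triangle_ineq4 add_mono[OF b1 b2]])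
  then show ?thesis by (simp add: mult_ac)
qed

lemma avg_tendsto:
  assumes f: "test_function K R f"
    and V: "(\<lambda>j. block_error f j \<omega>) \<longlonglongrightarrow> 0"
    and A: "(\<lambda>j. avg (4 ^ j) (trunc (block_scale j)) \<omega>) \<longlonglongrightarrow> 0"
  shows "(\<lambda>n. avg n (\<lambda>x. f (x /\<^sub>R (ln (real n) powr \<alpha>))) \<omega>) \<longlonglongrightarrow> integral\<^sup>L \<nu> f"
proof -
  \<comment> \<open>For \<open>n \<ge> 2\<close> this places \<open>n\<close> between the block ends
    with indices \<open>I n\<close> and \<open>I n + 1\<close>, because \<open>ln n\<close> lies
    between the corresponding square roots. Then \<open>q\<close> is a lower bound for the ratio of
    the logarithms and \<open>e\<close> an upper bound for the fraction of nodes added since the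
    block end.\<close>
  define I :: "nat \<Rightarrow> nat" where "I n = nat \<lfloor>(ln (real n))\<^sup>2\<rfloor>" for n
  have I: "filterlim I at_top at_top" unfolding I_def by real_asymp
  define q where "q i = sqrt (real i) / sqrt (real i + 1)" for i :: nat
  define e where "e i = 1 - exp (sqrt (real i) - sqrt (real i + 1))" for i :: nat
  have qlim: "(\<lambda>n. q (I n)) \<longlonglongrightarrow> 1"
    by (rule filterlim_compose[OF _ I]) (unfold q_def, real_asymp)
  have elim': "(\<lambda>n. e (I n)) \<longlonglongrightarrow> 0"
    by (rule filterlim_compose[OF _ I]) (unfold e_def, real_asymp)
  have qpow: "(\<lambda>n. q (I n) powr \<alpha>) \<longlonglongrightarrow> 1"
    using tendsto_powr[OF qlim tendsto_const[of \<alpha>]] by simp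
  have blk: "(\<lambda>n. avg (block_end (I n)) (\<lambda>x. f (x /\<^sub>R (ln (real (block_end (I n))) powr \<alpha>))) \<omega>)
      \<longlonglongrightarrow> integral\<^sup>L \<nu> f"
    by (rule filterlim_compose[OF block_avg_tendsto[OF f V A] I])
  have K: "K \<ge> 0" "R \<ge> 0" using f by (auto simp: test_function_def)
  have bound0: "(\<lambda>n. 2 * R * K * (1 - q (I n) powr \<alpha>) + 2 * K * e (I n)) \<longlonglongrightarrow> 2 * R * K * (1 - 1) + 2 * K * 0"
    by (intro tendsto_intros qpow elim')
  have "(\<lambda>n. avg n (\<lambda>x. f (x /\<^sub>R (ln (real n) powr \<alpha>))) \<omega>
      - avg (block_end (I n)) (\<lambda>x. f (x /\<^sub>R (ln (real (block_end (I n))) powr \<alpha>))) \<omega>) \<longlonglongrightarrow> 0"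
  proof (rule Lim_null_comparison)
    show "(\<lambda>n. 2 * R * K * (1 - q (I n) powr \<alpha>) + 2 * K * e (I n)) \<longlonglongrightarrow> 0" using bound0 by simp
    have "\<forall>\<^sub>F n in sequentially. 1 / 2 < q (I n) powr \<alpha>" by (rule order_tendstoD(1)[OF qpow]) simp
    moreover have "\<forall>\<^sub>F n in sequentially. 1 \<le> I n" using I by (simp add: filterlim_at_top)
    ultimately show "\<forall>\<^sub>F n in sequentially. norm (avg n (\<lambda>x. f (x /\<^sub>R (ln (real n) powr \<alpha>))) \<omega>
      - avg (block_end (I n)) (\<lambda>x. f (x /\<^sub>R (ln (real (block_end (I n))) powr \<alpha>))) \<omega>)
        \<le> 2 * R * K * (1 - q (I n) powr \<alpha>) + 2 * K * e (I n)"
      using eventually_ge_at_top[of "2::nat"]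
    proof eventually_elim
      case (elim n)
      define i t where "i = I n" "t = block_end i"
      note defs = this
      have ln0: "ln (real n) > 0" using elim(3) by simp
      have "real i = of_int \<lfloor>(ln (real n))\<^sup>2\<rfloor>" by (simp add: defs I_def)
      then have i: "real i \<le> (ln (real n))\<^sup>2" "(ln (real n))\<^sup>2 \<le> real i + 1" by linarith+
      have s1: "sqrt (real i) \<le> ln (real n)" using ln0 real_le_lsqrt[OF _ i(1)] by simp
      have s2: "ln (real n) \<le> sqrt (real i + 1)" using i(2) by (rule real_le_rsqrt)
      have expn: "exp (ln (real n)) = real n" using elim(3) by simp
      have "exp (sqrt (real i)) \<le> real n" using s1 expn by (metis exp_le_cancel_iff)
      \<comment> \<open>\<open>n\<close> is an integer, so rounding \<open>exp (sqrt i)\<close> up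
        does not pass it.\<close>
      then have tn: "t \<le> n" unfolding defs block_end_def by (simp add: ceiling_le_iff)
      have t1: "t \<ge> 1" unfolding defs by (rule block_end_pos)
      have "sqrt (real i) \<le> ln (real t)" unfolding defs by (rule ln_block_end_ge)
      have si: "sqrt (real i) \<ge> 1" using elim(2) by (simp add: defs)
      have lt: "0 < ln (real t)" "ln (real t) \<le> ln (real n)"
      proof -
        show "0 < ln (real t)" using \<open>sqrt (real i) \<le> ln (real t)\<close> si by linarith
        show "ln (real t) \<le> ln (real n)" using tn t1 by simp
      qed
      have "q i \<le> ln (real t) / ln (real n)"
        unfolding q_def using \<open>sqrt (real i) \<le> ln (real t)\<close> s2 ln0 lt by (intro frac_le) auto
      then have "q i powr \<alpha> \<le> (ln (real t) / ln (real n)) powr \<alpha>"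
        using \<alpha> by (intro powr_mono2) (auto simp: q_def)
      also have ratio: "(ln (real t) / ln (real n)) powr \<alpha> = ln (real t) powr \<alpha> / ln (real n) powr \<alpha>"
        using lt ln0 by (simp add: powr_divide)
      finally have qr: "q i powr \<alpha> \<le> ln (real t) powr \<alpha> / ln (real n) powr \<alpha>" .
      have r1: "ln (real t) powr \<alpha> / ln (real n) powr \<alpha> \<le> 1"
        unfolding ratio[symmetric] using lt ln0 \<alpha> by (intro powr_le1) auto
      have "\<bar>avg n (\<lambda>x. f (x /\<^sub>R (ln (real n) powr \<alpha>))) \<omega> - avg n (\<lambda>x. f (x /\<^sub>R (ln (real t) powr \<alpha>))) \<omega>\<bar>
          \<le> 2 * R * K * \<bar>ln (real t) powr \<alpha> / ln (real n) powr \<alpha> - 1\<bar>"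
      proof (rule avg_scale_diff[OF f])
        show "1 / 2 \<le> ln (real t) powr \<alpha> / ln (real n) powr \<alpha>"
          using qr elim(1) unfolding defs by linarith
      qed (use lt ln0 in auto)
      also have "\<dots> \<le> 2 * R * K * (1 - q i powr \<alpha>)"
        using qr r1 K by (intro mult_left_mono) auto
      finally have 1: "\<bar>avg n (\<lambda>x. f (x /\<^sub>R (ln (real n) powr \<alpha>))) \<omega> - avg n (\<lambda>x. f (x /\<^sub>R (ln (real t) powr \<alpha>))) \<omega>\<bar>
          \<le> 2 * R * K * (1 - q i powr \<alpha>)" .
      have "\<bar>avg n (\<lambda>x. f (x /\<^sub>R (ln (real t) powr \<alpha>))) \<omega> - avg t (\<lambda>x. f (x /\<^sub>R (ln (real t) powr \<alpha>))) \<omega>\<bar>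
          \<le> 2 * K * (1 - real t / real n)"
        by (rule avg_size_diff[OF test_function_bounded_borel[OF f] t1 tn])
      also have "\<dots> \<le> 2 * K * e i"
      proof -
        have "real n \<le> exp (sqrt (real i + 1))" using s2 expn by (metis exp_le_cancel_iff)
        then have "exp (sqrt (real i)) / exp (sqrt (real i + 1)) \<le> real t / real n"
          using block_end_ge[of i] elim(3) by (intro frac_le) (auto simp: defs)
        then show ?thesis using K by (intro mult_left_mono) (auto simp: e_def exp_diff)
      qed
      finally show ?case using 1 unfolding defs real_norm_def by linarith
    qed
  qed
  from tendsto_add[OF this blk] show ?thesis by simp
qed

lemma AE_avg_tendsto:
  assumes f: "test_function K R f"
  shows "AE \<omega> in M. (\<lambda>n. avg n (\<lambda>x. f (x /\<^sub>R (ln (real n) powr \<alpha>))) \<omega>) \<longlonglongrightarrow> integral\<^sup>L \<nu> f"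
  using AE_block_error[OF f] AE_trunc_avg by eventually_elim (rule avg_tendsto[OF f])

lemma AE_weak_conv:
  assumes X: "AE \<omega> in M. X 1 \<omega> = \<Delta> 1 \<omega> \<and> (\<forall>n\<ge>2. X n \<omega> = X (U n \<omega>) \<omega> + \<Delta> n \<omega>)"
  shows "AE \<omega> in M. weak_conv_fm
           (\<lambda>n. Theta (ln (real n) powr \<alpha>)
                   (scale_measure (ennreal (1 / real n)) (point_sum n (\<lambda>i. X i \<omega>)))) \<nu>"
proof -
  obtain D :: "'d set" where D: "countable D" "\<And>S. open S \<Longrightarrow> S \<noteq> {} \<Longrightarrow> \<exists>d\<in>D. d \<in> S"
    using countable_dense_setE by blast
  have "x \<in> closure D" for x
    unfolding closure_approachable
    using D(2)[of "ball x _"] by (force simp: dist_commute)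
  then have clD: "closure D = UNIV" by auto
  let ?\<T> = "lists (D \<times> (UNIV :: (nat \<times> rat) set))"
  have test: "\<exists>K R. test_function K R (max_tents ps)" for ps :: "('d \<times> nat \<times> rat) list"
    using max_tents_cs[of ps 0] unfolding test_function_def by (auto simp: dist_real_def)
  have cT: "countable ?\<T>" using D(1) by auto
  \<comment> \<open>The family is countable, so a single null set serves all its members.\<close>
  have "AE \<omega> in M. \<forall>ps\<in>?\<T>. (\<lambda>n. avg n (\<lambda>x. max_tents ps (x /\<^sub>R (ln (real n) powr \<alpha>))) \<omega>)
      \<longlonglongrightarrow> integral\<^sup>L \<nu> (max_tents ps)"
    unfolding AE_ball_countable[OF cT] using test AE_avg_tendsto by blast
  then show ?thesis
    using AE_pos[OF X]
  proof eventually_elim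
    case (elim \<omega>)
    let ?\<nu>s = "\<lambda>n. Theta (ln (real n) powr \<alpha>)
                   (scale_measure (ennreal (1 / real n)) (point_sum n (\<lambda>i. X i \<omega>)))"
    show ?case
    proof (rule weak_conv_fm_max_tents[OF D(1) clD _ _ \<nu>])
      \<comment> \<open>For \<open>n = 0\<close> the measure is null. For \<open>n = 1\<close> the
        scale is 0 and division by it gives 0, so all mass sits at the origin and the total is still
        one.\<close>
      show "prob_space (?\<nu>s n)" if "n \<ge> 1" for n by (rule prob_space_Theta_point_sum[OF that])
      show "sets (?\<nu>s n) = sets borel" for n by (simp add: Theta_def)
      fix ps assume ps: "ps \<in> ?\<T>"
      have "integral\<^sup>L (?\<nu>s n) (max_tents ps) = avg n (\<lambda>x. max_tents ps (x /\<^sub>R (ln (real n) powr \<alpha>))) \<omega>" for n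
      proof -
        have "(\<Sum>i=1..n. max_tents ps (X i \<omega> /\<^sub>R (ln (real n) powr \<alpha>)))
            = (\<Sum>i=1..n. max_tents ps (pos i \<omega> /\<^sub>R (ln (real n) powr \<alpha>)))"
          using elim(2) by (intro sum.cong) auto
        then show ?thesis
          unfolding avg_def
          using integral_Theta_point_sum[OF borel_measurable_continuous_onI[OF continuous_on_max_tents[of ps]]]
          by simp
      qed
      then show "(\<lambda>n. integral\<^sup>L (?\<nu>s n) (max_tents ps)) \<longlonglongrightarrow> integral\<^sup>L \<nu> (max_tents ps)"
        using elim(1) ps by simp
    qed
  qed
qed

end

theorem theorem1:
  fixes M :: "'s measure"
    and \<Delta> :: "nat \<Rightarrow> 's \<Rightarrow> 'd::euclidean_space"
    and U :: "nat \<Rightarrow> 's \<Rightarrow> nat"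
    and X :: "nat \<Rightarrow> 's \<Rightarrow> 'd"
    and \<Lambda> :: "'s \<Rightarrow> 'd"
    and \<alpha> :: real
  assumes "prob_space M"
    and meas_\<Delta>: "\<And>i. i \<ge> 1 \<Longrightarrow> \<Delta> i \<in> borel_measurable M"
    and ident: "\<And>i. i \<ge> 1 \<Longrightarrow> distr M borel (\<Delta> i) = distr M borel (\<Delta> 1)"
    and meas_U: "\<And>n. n \<ge> 2 \<Longrightarrow> U n \<in> measurable M (count_space UNIV)"
    and unif: "\<And>n. n \<ge> 2 \<Longrightarrow>
        distr M (count_space UNIV) (U n) = uniform_measure (count_space UNIV) {1..n-1}"
    and indep: "prob_space.indep_sets M
        (\<lambda>j. case j of
               Inl i \<Rightarrow> {\<Delta> i -` A \<inter> space M | A. A \<in> sets borel}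
             | Inr n \<Rightarrow> {U n -` A \<inter> space M | A. A \<in> sets (count_space UNIV)})
        (Inl ` {1..} \<union> Inr ` {2..})"
    and X_def: "AE \<omega> in M. X 1 \<omega> = \<Delta> 1 \<omega> \<and>
                  (\<forall>n\<ge>2. X n \<omega> = X (U n \<omega>) \<omega> + \<Delta> n \<omega>)"
    and "\<alpha> > 0"
    and meas_\<Lambda>: "\<Lambda> \<in> borel_measurable M"
    and conv: "weak_conv_fm
        (\<lambda>n. distr M borel (\<lambda>\<omega>. (real n powr (-\<alpha>)) *\<^sub>R (\<Sum>i\<in>{1..n}. \<Delta> i \<omega>)))
        (distr M borel \<Lambda>)"
  shows "AE \<omega> in M. weak_conv_fm
           (\<lambda>n. Theta (ln (real n) powr \<alpha>)
                   (scale_measure (ennreal (1 / real n)) (point_sum n (\<lambda>i. X i \<omega>))))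
           (distr M borel \<Lambda>)"
proof -
  interpret M: prob_space M by fact
  interpret random_recursive_walk M \<Delta> U
    by unfold_locales (fact meas_\<Delta> ident meas_U unif indep)+
  interpret scaled_random_recursive_walk M \<Delta> U \<alpha> "distr M borel \<Lambda>"
    by (intro scaled_random_recursive_walk.intro scaled_random_recursive_walk_axioms.intro
      random_recursive_walk_axioms)
      (fact \<open>\<alpha> > 0\<close> M.prob_space_distr[OF meas_\<Lambda>] sets_distr conv)+
  show ?thesis by (rule AE_weak_conv[OF X_def])
qed

end
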